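(* Let $n \geq 3$ and let $H_f$ and $H_g$ be two classical hedgehogs in $\mathbb{E}^n$ with twice continuously differentiable support functions $f, g : S^{n-1} \to \mathbb{R}$. Assume that for every two-dimensional plane $\alpha$ passing through the origin the projections of $H_f$ and $H_g$ onto $\alpha$ are directly congruent and have no direct rigid motion symmetries. Then there exists $b \in \mathbb{E}^n$ such that $H_g = H_f + b$ or $H_g = -H_f + b$.
   Context: $\mathbb{E}^n$ is $n$-dimensional Euclidean space with scalar product $x\cdot y$, and $S^{n-1}$ is the set of its unit vectors. Given a twice continuously differentiable function $h : S^{n-1} \to \mathbb{R}$, the classical hedgehog $H_h \subset \mathbb{E}^n$ with support function $h$ is the envelope of the family of hyperplanes $\{x \in \mathbb{E}^n : x \cdot u = h(u)\}$, $u \in S^{n-1}$. The projection of $H_h$ onto a linear subspace $\alpha$ is the envelope in $\alpha$ of the hyperplanes $\{x \in \alpha : x \cdot u = h(u)\}$, $u \in \alpha \cap S^{n-1}$; it is the classical hedgehog $H_{h|_\alpha}\subset\alpha$ with support function $h|_\alpha$, the restriction of $h$ to $\alpha \cap S^{n-1}$. Hedgehogs are considered together with their support functions: for an orthogonal map $\phi$, the image $\phi(H_h)$ is the hedgehog with support function $u \mapsto h(\phi^T(u))$, where $\phi^T$ is the transpose of $\phi$; for a vector $a$, the translate $H_h + a$ is the hedgehog with support function $u \mapsto h(u) + a \cdot u$. In particular, $-H_h$ is the hedgehog with support function $u \mapsto h(-u)$. Rotations of a plane $\alpha$ are the orthogonal linear maps of $\alpha$ with determinant $1$. Two hedgehogs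 in a two-dimensional plane $\alpha$ are directly congruent if a rotation of $\alpha$ carries one of them to a translate of the other; thus $H_{f|_\alpha}$ and $H_{g|_\alpha}$ are directly congruent when there are a rotation $\psi$ of $\alpha$ and $a \in \alpha$ with $f(\psi^T(u)) + a \cdot u = g(u)$ for all $u \in \alpha \cap S^{n-1}$. A hedgehog $H_h$ in $\alpha$ has a direct rigid motion symmetry if it is directly congruent to itself through a non-trivial rotation, i.e. there are a non-identity rotation $\psi$ of $\alpha$ and $a \in \alpha$ with $h(\psi^T(u)) + a \cdot u = h(u)$ for all $u \in \alpha \cap S^{n-1}$. *)

theory Defs
  imports "HOL-Analysis.Analysis"
begin

definition C2_on :: "('a::real_normed_vector \<Rightarrow> 'b::real_normed_vector) \<Rightarrow> 'a set \<Rightarrow> bool" where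
  "C2_on F U \<longleftrightarrow>
    (\<exists>(F' :: 'a \<Rightarrow> 'a \<Rightarrow>\<^sub>L 'b) (F'' :: 'a \<Rightarrow> 'a \<Rightarrow>\<^sub>L ('a \<Rightarrow>\<^sub>L 'b)).
       (\<forall>x\<in>U. (F has_derivative blinfun_apply (F' x)) (at x) \<and>
              (F' has_derivative blinfun_apply (F'' x)) (at x)) \<and>
       continuous_on U F'')"

(* C^2 on the unit sphere as an embedded submanifold: locally the restriction of a C^2 function
   of the ambient space. Only the values of h on the sphere matter. *)
definition C2_on_sphere :: "('a::real_inner \<Rightarrow> real) \<Rightarrow> bool" where
  "C2_on_sphere h \<longleftrightarrow>
    (\<forall>u\<in>sphere 0 1. \<exists>U F. open U \<and> u \<in> U \<and> C2_on F U \<and> (\<forall>v\<in>U \<inter> sphere 0 1. F v = h v))"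

definition unit_sphere :: "'a::real_inner set \<Rightarrow> 'a set" where
  "unit_sphere \<alpha> = \<alpha> \<inter> sphere 0 1"

(* The envelope in \<alpha> of the hyperplanes {x \<in> \<alpha>. x \<bullet> u = h u}, u in the unit sphere of \<alpha>: the points
   lying on one of these hyperplanes at a parameter u where the defining function v \<mapsto> x \<bullet> v - h v is
   stationary. The derivative is taken along the sphere, so only tangential directions count. *)
definition envelope :: "'a::real_inner set \<Rightarrow> ('a \<Rightarrow> real) \<Rightarrow> 'a set" where
  "envelope \<alpha> h =
    {x \<in> \<alpha>. \<exists>u\<in>unit_sphere \<alpha>. x \<bullet> u = h u \<and>
       ((\<lambda>v. x \<bullet> v - h v) has_derivative (\<lambda>_. 0)) (at u within unit_sphere \<alpha>)}"

(* A hedgehog is considered together with its support function and the linear space it lives in.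
   The point set alone need not determine the support function. *)
record 'a hedgehog =
  hh_space :: "'a set"
  hh_support :: "'a \<Rightarrow> real"
  hh_points :: "'a set"

(* The support function is normalised outside the unit sphere of \<alpha> by restrict, so that equality
   of hedgehogs only concerns its values on that sphere. *)
definition hedgehog :: "'a::real_inner set \<Rightarrow> ('a \<Rightarrow> real) \<Rightarrow> 'a hedgehog" where
  "hedgehog \<alpha> h = \<lparr>hh_space = \<alpha>, hh_support = restrict h (unit_sphere \<alpha>), hh_points = envelope \<alpha> h\<rparr>"

definition hh_project :: "'a::real_inner set \<Rightarrow> 'a hedgehog \<Rightarrow> 'a hedgehog" where
  "hh_project \<alpha> H = hedgehog \<alpha> (hh_support H)"

definition hh_translate :: "'a::real_inner \<Rightarrow> 'a hedgehog \<Rightarrow> 'a hedgehog" where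
  "hh_translate a H = hedgehog (hh_space H) (\<lambda>u. hh_support H u + a \<bullet> u)"

(* Intended for orthogonal \<phi>. *)
definition hh_image :: "('a::euclidean_space \<Rightarrow> 'a) \<Rightarrow> 'a hedgehog \<Rightarrow> 'a hedgehog" where
  "hh_image \<phi> H = hedgehog (\<phi> ` hh_space H) (\<lambda>u. hh_support H (adjoint \<phi> u))"

definition hh_minus :: "'a::euclidean_space hedgehog \<Rightarrow> 'a hedgehog" where
  "hh_minus H = hh_image uminus H"

(* A rotation of the subspace \<alpha>, represented by its extension to the whole space by the identity on
   the orthogonal complement of \<alpha>. The extension is unique, has the same determinant, is the identity
   iff the rotation is, and its adjoint restricts on \<alpha> to the transpose of the rotation. *)
definition rotation_of :: "(real^'n) set \<Rightarrow> (real^'n \<Rightarrow> real^'n) \<Rightarrow> bool" where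
  "rotation_of \<alpha> \<psi> \<longleftrightarrow>
    orthogonal_transformation \<psi> \<and> \<psi> ` \<alpha> = \<alpha> \<and> (\<forall>x\<in>orthogonal_comp \<alpha>. \<psi> x = x) \<and>
    det (matrix \<psi>) = 1"

definition directly_congruent :: "(real^'n) hedgehog \<Rightarrow> (real^'n) hedgehog \<Rightarrow> bool" where
  "directly_congruent H K \<longleftrightarrow>
    (\<exists>\<psi> a. rotation_of (hh_space H) \<psi> \<and> a \<in> hh_space H \<and> hh_translate a (hh_image \<psi> H) = K)"

definition direct_rigid_motion_symmetry :: "(real^'n) hedgehog \<Rightarrow> bool" where
  "direct_rigid_motion_symmetry H \<longleftrightarrow>
    (\<exists>\<psi> a. rotation_of (hh_space H) \<psi> \<and> \<psi> \<noteq> id \<and> a \<in> hh_space H \<and>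
       hh_translate a (hh_image \<psi> H) = H)"

lemma envelope_cong:
  assumes "\<And>u. u \<in> unit_sphere \<alpha> \<Longrightarrow> h u = k u"
  shows "envelope \<alpha> h = envelope \<alpha> k"
proof -
  have sub: "envelope \<alpha> p \<subseteq> envelope \<alpha> q" if eq: "\<And>u. u \<in> unit_sphere \<alpha> \<Longrightarrow> p u = q u" for p q
  proof
    fix x assume "x \<in> envelope \<alpha> p"
    then obtain u where u: "x \<in> \<alpha>" "u \<in> unit_sphere \<alpha>" "x \<bullet> u = p u"
      and d: "((\<lambda>v. x \<bullet> v - p v) has_derivative (\<lambda>_. 0)) (at u within unit_sphere \<alpha>)"
      unfolding envelope_def by blast
    have "((\<lambda>v. x \<bullet> v - q v) has_derivative (\<lambda>_. 0)) (at u within unit_sphere \<alpha>)"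
      by (rule has_derivative_transform[OF u(2) _ d]) (simp add: eq)
    moreover have "x \<bullet> u = q u"
      using u eq by simp
    ultimately show "x \<in> envelope \<alpha> q"
      unfolding envelope_def using u by blast
  qed
  show ?thesis
    by (intro equalityI sub) (simp_all add: assms)
qed

lemma hedgehog_eq_iff:
  "hedgehog \<alpha> h = hedgehog \<alpha> k \<longleftrightarrow> (\<forall>u\<in>unit_sphere \<alpha>. h u = k u)"
proof
  assume "hedgehog \<alpha> h = hedgehog \<alpha> k"
  then have "restrict h (unit_sphere \<alpha>) = restrict k (unit_sphere \<alpha>)"
    by (simp add: hedgehog_def)
  then show "\<forall>u\<in>unit_sphere \<alpha>. h u = k u"
    by (auto simp: fun_eq_iff restrict_def split: if_splits)
next
  assume "\<forall>u\<in>unit_sphere \<alpha>. h u = k u"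
  then have "envelope \<alpha> h = envelope \<alpha> k" "restrict h (unit_sphere \<alpha>) = restrict k (unit_sphere \<alpha>)"
    using envelope_cong[of \<alpha> h k] restrict_ext[of "unit_sphere \<alpha>" h k] by simp_all
  then show "hedgehog \<alpha> h = hedgehog \<alpha> k"
    by (simp add: hedgehog_def)
qed

lemma hedgehog_sel:
  "hh_space (hedgehog \<alpha> h) = \<alpha>"
  "hh_support (hedgehog \<alpha> h) = restrict h (unit_sphere \<alpha>)"
  by (simp_all add: hedgehog_def)

lemma hh_translate_hedgehog:
  "hh_translate a (hedgehog \<alpha> h) = hedgehog \<alpha> (\<lambda>u. h u + a \<bullet> u)"
  unfolding hh_translate_def hedgehog_sel hedgehog_eq_iff by simp

lemma hh_project_hedgehog:
  "hh_project \<alpha> (hedgehog UNIV h) = hedgehog \<alpha> h"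
  unfolding hh_project_def hedgehog_sel hedgehog_eq_iff by (simp add: unit_sphere_def)

lemma hh_minus_hedgehog:
  fixes h :: "'a::euclidean_space \<Rightarrow> real"
  shows "hh_minus (hedgehog UNIV h) = hedgehog UNIV (\<lambda>u. h (- u))"
proof -
  have "adjoint (uminus :: 'a \<Rightarrow> 'a) = uminus"
    by (rule adjoint_unique) simp
  moreover have "range (uminus :: 'a \<Rightarrow> 'a) = UNIV"
    by simp
  ultimately show ?thesis
    unfolding hh_minus_def hh_image_def hedgehog_sel
    by (simp only: hedgehog_eq_iff) (simp add: unit_sphere_def)
qed

lemma hh_image_hedgehog:
  assumes "rotation_of \<alpha> \<psi>"
  shows "hh_image \<psi> (hedgehog \<alpha> h) = hedgehog \<alpha> (\<lambda>u. h (adjoint \<psi> u))"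
proof -
  have orth: "orthogonal_transformation \<psi>" and im: "\<psi> ` \<alpha> = \<alpha>"
    using assms by (auto simp: rotation_of_def)
  have lin: "linear \<psi>"
    using orth by (rule orthogonal_transformation_linear)
  have adj: "adjoint \<psi> (\<psi> v) = v" for v
  proof -
    have "x \<bullet> adjoint \<psi> (\<psi> v) = x \<bullet> v" for x
      using orth by (simp add: adjoint_works[OF lin] orthogonal_transformation_def)
    then show ?thesis
      using vector_eq_ldot by blast
  qed
  have "adjoint \<psi> u \<in> unit_sphere \<alpha>" if u: "u \<in> unit_sphere \<alpha>" for u
  proof -
    obtain v where v: "v \<in> \<alpha>" "u = \<psi> v"
      using u im by (auto simp: unit_sphere_def)
    have "norm v = 1"
      using u v orthogonal_transformation_norm[OF orth, of v] by (simp add: unit_sphere_def)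
    then show ?thesis
      using v by (simp add: adj unit_sphere_def)
  qed
  then show ?thesis
    unfolding hh_image_def hedgehog_sel im hedgehog_eq_iff by simp
qed

lemma envelope_translate:
  assumes "subspace \<alpha>" "a \<in> \<alpha>"
  shows "envelope \<alpha> (\<lambda>u. h u + a \<bullet> u) = (+) a ` envelope \<alpha> h"
proof (intro set_eqI iffI)
  fix x assume "x \<in> envelope \<alpha> (\<lambda>u. h u + a \<bullet> u)"
  then have "x - a \<in> envelope \<alpha> h"
    using assms by (auto simp: envelope_def inner_diff_left algebra_simps subspace_diff)
  then show "x \<in> (+) a ` envelope \<alpha> h"
    by (intro image_eqI[of _ _ "x - a"]) simp_all
next
  fix x assume "x \<in> (+) a ` envelope \<alpha> h"
  then obtain y where y: "y \<in> envelope \<alpha> h" "x = a + y" by blast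
  then show "x \<in> envelope \<alpha> (\<lambda>u. h u + a \<bullet> u)"
    using assms by (auto simp: envelope_def inner_add_left algebra_simps subspace_add)
qed

lemma directly_congruent_iff:
  "directly_congruent (hedgehog \<alpha> f) (hedgehog \<alpha> g) \<longleftrightarrow>
    (\<exists>\<psi> a. rotation_of \<alpha> \<psi> \<and> a \<in> \<alpha> \<and> (\<forall>u\<in>unit_sphere \<alpha>. f (adjoint \<psi> u) + a \<bullet> u = g u))"
  unfolding directly_congruent_def hedgehog_sel
  by (simp add: hh_image_hedgehog hh_translate_hedgehog hedgehog_eq_iff cong: conj_cong)

lemma direct_rigid_motion_symmetry_iff:
  "direct_rigid_motion_symmetry (hedgehog \<alpha> h) \<longleftrightarrow>
    (\<exists>\<psi> a. rotation_of \<alpha> \<psi> \<and> \<psi> \<noteq> id \<and> a \<in> \<alpha> \<and> (\<forall>u\<in>unit_sphere \<alpha>. h (adjoint \<psi> u) + a \<bullet> u = h u))"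
  unfolding direct_rigid_motion_symmetry_def hedgehog_sel
  by (simp add: hh_image_hedgehog hh_translate_hedgehog hedgehog_eq_iff cong: conj_cong)

end

theory Submission
  imports Defs
begin

text \<open>Extend support functions to positively homogeneous functions \<open>F\<close>, \<open>G\<close> on the whole space. Translating
a hedgehog by \<open>a\<close> adds the linear functional \<open>x \<mapsto> a \<bullet> x\<close>, so the task is to show that \<open>G\<close> and
\<open>F\<close>, or \<open>G\<close> and \<open>x \<mapsto> F (- x)\<close>, differ by a linear functional.

In dimension three every plane through the origin is \<open>\<xi>\<^sup>\<bottom>\<close> for a unit vector \<open>\<xi>\<close>, which also orients it.
The rotation of \<open>\<xi>\<^sup>\<bottom>\<close> that carries one projection to a translate of the other is unique, since the
projection of \<open>F\<close> has no symmetry. A compactness argument turns uniqueness into continuity in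
\<open>\<xi>\<close> (\<open>congruence_angle_continuous\<close>), and reversing the orientation inverts the rotation. As the
2-sphere has no nontrivial coverings, the rotation angle lifts to a continuous real function,
which is odd up to adding a constant multiple of \<open>\<pi>\<close> (\<open>odd_angle_lift\<close>). Replacing \<open>F\<close> by
\<open>x \<mapsto> F (- x)\<close> if this multiple is odd, one gets an odd continuous angle \<open>\<theta>\<close> on the sphere. It
vanishes somewhere on every curve that joins a point to its antipode, and \<open>h = G - F\<close> is linear on
\<open>\<xi>\<^sup>\<bottom>\<close> for each zero \<open>\<xi>\<close> of \<open>\<theta>\<close>.

Such an \<open>h\<close> is linear (\<open>homogeneous_linear_if_linear_on_planes\<close>). Every great circle contains a zero of
\<open>\<theta>\<close>; hence the planes \<open>\<xi>\<^sup>\<bottom>\<close> with \<open>\<theta> \<xi> = 0\<close> cover the space, and there are two orthogonal zeros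
\<open>p\<close>, \<open>q\<close>. After subtracting a linear functional, \<open>h\<close> vanishes on \<open>p\<^sup>\<bottom>\<close> and \<open>q\<^sup>\<bottom>\<close>. If some zero of \<open>\<theta>\<close> lies
outside the plane of \<open>p\<close> and \<open>q\<close>, then for every zero \<open>\<xi>\<close> the plane \<open>\<xi>\<^sup>\<bottom>\<close> meets planes on which \<open>h\<close> is known to vanish in two
different lines, so \<open>h\<close> vanishes on \<open>\<xi>\<^sup>\<bottom>\<close>. Otherwise the zeros of \<open>\<theta>\<close> fill the great circle through \<open>p\<close>
and \<open>q\<close>; then \<open>h\<close> is invariant under translation along \<open>w = p \<times> q\<close>, and its derivative at \<open>w\<close>
coincides with \<open>h\<close> on \<open>w\<^sup>\<bottom>\<close>, which makes \<open>h\<close> linear there.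

In higher dimensions the three-dimensional result holds on every three-dimensional subspace, up to a
sign that is determined already by any plane in it. Any two planes are linked by two
three-dimensional subspaces that share a plane, so the sign is the same throughout
(\<open>common_sign\<close>). A function that is linear on every plane is linear.\<close>

section \<open>Continuity of a uniquely determined solution\<close>

text \<open>If a compact relation determines \<open>\<phi> x\<close> uniquely for every \<open>x \<in> S\<close>, then it is the graph of \<open>\<phi>\<close>,
and a function with closed graph and compact target is continuous.\<close>
lemma continuous_on_unique_selection:
  fixes \<phi> :: "'a::euclidean_space \<Rightarrow> 'b::euclidean_space"
  assumes R: "compact R" and dom: "fst ` R \<subseteq> S"
    and sel: "\<And>x. x \<in> S \<Longrightarrow> (x, \<phi> x) \<in> R"
    and uniq: "\<And>x y. (x, y) \<in> R \<Longrightarrow> y = \<phi> x"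
  shows "continuous_on S \<phi>"
proof -
  have graph: "(\<lambda>x. (x, \<phi> x)) ` S = R"
    using sel dom uniq by force
  have "compact (snd ` R)"
    by (intro compact_continuous_image continuous_intros R)
  moreover have "\<phi> \<in> S \<rightarrow> snd ` R"
    using sel by force
  moreover have "closedin (top_of_set (S \<times> snd ` R)) R"
    using dom by (intro closed_subset compact_imp_closed R) force
  ultimately show ?thesis
    by (simp add: continuous_closed_graph_eq graph)
qed

section \<open>Planes and great circles in three-space\<close>

unbundle cross3_syntax

lemma cross_unit:
  fixes x y :: "real^3"
  assumes "norm x = 1" "norm y = 1" "x \<bullet> y = 0"
  shows "norm (x \<times> y) = 1"
  using norm_cross[of x y] assms norm_ge_zero[of "x \<times> y"] by (simp add: power2_eq_1_iff)

lemma unit_orthogonal_exists: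
  fixes x :: "real^3"
  obtains p where "norm p = 1" "x \<bullet> p = 0"
proof -
  obtain y where "y \<noteq> 0" "orthogonal x y"
    by (rule orthogonal_to_vector_exists[of x]) simp_all
  then show ?thesis
    using that[of "y /\<^sub>R norm y"] by (simp add: orthogonal_def)
qed

lemma orthonormal_expansion:
  fixes p q :: "real^3"
  assumes p: "norm p = 1" and q: "norm q = 1" and pq: "p \<bullet> q = 0"
  shows "x = (x \<bullet> p) *\<^sub>R p + (x \<bullet> q) *\<^sub>R q + (x \<bullet> (p \<times> q)) *\<^sub>R (p \<times> q)"
proof -
  define y where "y = x - (x \<bullet> p) *\<^sub>R p - (x \<bullet> q) *\<^sub>R q"
  have y: "p \<bullet> y = 0" "q \<bullet> y = 0"
    using p q pq by (simp_all add: y_def inner_diff_right inner_commute norm_eq_1)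
  have "(p \<times> q) \<times> y = 0"
    using y cross_skew[of "p \<times> q" y] by (simp add: Lagrange inner_commute)
  then have "((p \<times> q) \<bullet> (p \<times> q)) *\<^sub>R y = ((p \<times> q) \<bullet> y) *\<^sub>R (p \<times> q)"
    using Lagrange[of "p \<times> q" "p \<times> q" y] by simp
  moreover have "(p \<times> q) \<bullet> (p \<times> q) = 1"
    using cross_unit[OF p q pq] by (simp add: norm_eq_1)
  moreover have "(p \<times> q) \<bullet> y = x \<bullet> (p \<times> q)"
    by (simp add: y_def inner_diff_right dot_cross_self inner_commute)
  ultimately show ?thesis
    by (simp add: y_def algebra_simps)
qed

lemma plane_spanned:
  fixes \<xi> :: "real^3"
  assumes "\<xi> \<noteq> 0" "\<xi> \<bullet> v = 0" "\<xi> \<bullet> w = 0" "\<xi> \<bullet> x = 0" and vw: "v \<times> w \<noteq> 0"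
  obtains s t where "x = s *\<^sub>R v + t *\<^sub>R w"
proof -
  define n where "n = v \<times> w"
  have "\<xi> \<times> n = 0"
    using assms by (simp add: n_def Lagrange)
  then have "(\<xi> \<bullet> \<xi>) *\<^sub>R n = (\<xi> \<bullet> n) *\<^sub>R \<xi>"
    using Lagrange[of \<xi> \<xi> n] by simp
  then have "(\<xi> \<bullet> \<xi>) * (n \<bullet> x) = (\<xi> \<bullet> n) * (\<xi> \<bullet> x)"
    by (metis inner_scaleR_left)
  then have "n \<bullet> x = 0"
    using assms by simp
  then have "(n \<bullet> n) *\<^sub>R x = n \<times> (x \<times> n)"
    by (simp add: Lagrange)
  also have "\<dots> = (x \<bullet> w) *\<^sub>R (n \<times> v) - (x \<bullet> v) *\<^sub>R (n \<times> w)"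
    by (simp add: n_def Lagrange[of x v w] Cross3.right_diff_distrib cross_mult_right)
  also have "n \<times> v = (v \<bullet> v) *\<^sub>R w - (v \<bullet> w) *\<^sub>R v"
    using cross_skew[of n v] by (simp add: n_def Lagrange)
  also have "n \<times> w = (v \<bullet> w) *\<^sub>R w - (w \<bullet> w) *\<^sub>R v"
    using cross_skew[of n w] by (simp add: n_def Lagrange inner_commute)
  finally have "(n \<bullet> n) *\<^sub>R x = ((x \<bullet> v) * (w \<bullet> w) - (x \<bullet> w) * (v \<bullet> w)) *\<^sub>R v
      + ((x \<bullet> w) * (v \<bullet> v) - (x \<bullet> v) * (v \<bullet> w)) *\<^sub>R w" (is "_ = ?s *\<^sub>R v + ?t *\<^sub>R w")
    by (simp add: algebra_simps)
  then have "inverse (n \<bullet> n) *\<^sub>R (n \<bullet> n) *\<^sub>R x = inverse (n \<bullet> n) *\<^sub>R (?s *\<^sub>R v + ?t *\<^sub>R w)"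
    by metis
  moreover have "n \<bullet> n \<noteq> 0"
    using vw by (simp add: n_def)
  ultimately have "x = (?s / (n \<bullet> n)) *\<^sub>R v + (?t / (n \<bullet> n)) *\<^sub>R w"
    by (simp add: scaleR_add_right divide_inverse mult.commute)
  then show ?thesis by (rule that)
qed

lemma linear_on_plane_eq_0:
  fixes \<xi> :: "real^3" and k :: "real^3 \<Rightarrow> real"
  assumes lin: "\<And>x. \<xi> \<bullet> x = 0 \<Longrightarrow> k x = a \<bullet> x" and "\<xi> \<noteq> 0"
    and "\<xi> \<bullet> v = 0" "\<xi> \<bullet> w = 0" "v \<times> w \<noteq> 0" "k v = 0" "k w = 0" "\<xi> \<bullet> x = 0"
  shows "k x = 0"
proof -
  obtain s t where x: "x = s *\<^sub>R v + t *\<^sub>R w"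
    using plane_spanned assms by metis
  have "a \<bullet> v = 0" "a \<bullet> w = 0"
    using assms by simp_all
  then show ?thesis
    using lin[OF \<open>\<xi> \<bullet> x = 0\<close>] by (simp add: x inner_add_right)
qed

lemma norm_cos_sin_combination:
  fixes p q :: "'a::real_inner"
  assumes "norm p = 1" "norm q = 1" "p \<bullet> q = 0"
  shows "norm (cos t *\<^sub>R p + sin t *\<^sub>R q) = 1"
  using assms
  by (simp add: norm_eq_1 inner_add_left inner_add_right inner_commute[of q p] flip: power2_eq_square)

section \<open>Zeros of odd functions on the sphere\<close>

lemma odd_zero_on_half_circle:
  fixes \<theta> :: "'a::real_inner \<Rightarrow> real"
  assumes cont: "continuous_on (sphere 0 1) \<theta>"
    and odd: "\<And>x. norm x = 1 \<Longrightarrow> \<theta> (- x) = - \<theta> x"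
    and pq: "norm p = 1" "norm q = 1" "p \<bullet> q = 0"
  obtains t where "\<theta> (cos t *\<^sub>R p + sin t *\<^sub>R q) = 0" "0 \<le> t" "t \<le> pi"
proof -
  define \<gamma> where "\<gamma> = (\<lambda>t. cos t *\<^sub>R p + sin t *\<^sub>R q)"
  have "norm (\<gamma> t) = 1" for t
    unfolding \<gamma>_def by (rule norm_cos_sin_combination) (use pq in auto)
  then have "continuous_on {0..pi} (\<lambda>t. \<theta> (\<gamma> t))"
    unfolding \<gamma>_def
    by (intro continuous_on_compose2[OF cont] continuous_intros) auto
  moreover have "\<theta> (\<gamma> pi) = - \<theta> (\<gamma> 0)"
    using odd pq by (simp add: \<gamma>_def)
  ultimately have "\<exists>t. 0 \<le> t \<and> t \<le> pi \<and> \<theta> (\<gamma> t) = 0"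
    using IVT'[of "\<lambda>t. \<theta> (\<gamma> t)" 0 0 pi] IVT2'[of "\<lambda>t. \<theta> (\<gamma> t)" pi 0 0]
    by (cases "\<theta> (\<gamma> 0) \<le> 0") auto
  then show ?thesis
    using that by (auto simp: \<gamma>_def)
qed

lemma odd_zero_on_great_circle:
  fixes \<theta> :: "real^3 \<Rightarrow> real"
  assumes cont: "continuous_on (sphere 0 1) \<theta>"
    and odd: "\<And>x. norm x = 1 \<Longrightarrow> \<theta> (- x) = - \<theta> x"
  obtains \<xi> where "norm \<xi> = 1" "x \<bullet> \<xi> = 0" "\<theta> \<xi> = 0"
proof -
  obtain p where p: "norm p = 1" "x \<bullet> p = 0"
    using unit_orthogonal_exists .
  obtain q where q: "norm q = 1" "x \<bullet> q = 0" "p \<bullet> q = 0"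
  proof (cases "x = 0")
    case True
    then show ?thesis
      using that unit_orthogonal_exists[of p] by auto
  next
    case False
    have "p \<times> x \<noteq> 0"
      using False p norm_and_cross_eq_0[of p x] by (auto simp: inner_commute)
    then show ?thesis
      using that[of "(p \<times> x) /\<^sub>R norm (p \<times> x)"] by (simp add: dot_cross_self)
  qed
  obtain t where t: "\<theta> (cos t *\<^sub>R p + sin t *\<^sub>R q) = 0"
    using odd_zero_on_half_circle[OF cont odd p(1) q(1) q(3)] by blast
  moreover have "norm (cos t *\<^sub>R p + sin t *\<^sub>R q) = 1"
    by (rule norm_cos_sin_combination) (use p q in auto)
  ultimately show ?thesis
    using that p q by (simp add: inner_add_right)
qed

section \<open>Homogeneous functions that are linear on many planes\<close>

text \<open>The zeros of \<open>\<theta>\<close> serve to select the normals \<open>\<xi>\<close> of the planes on which \<open>h\<close> is linear. Only one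
consequence of oddness matters: every half great circle has a zero of \<open>\<theta>\<close> on it.\<close>
lemma homogeneous_linear_if_linear_on_planes:
  fixes h :: "real^3 \<Rightarrow> real" and \<theta> :: "real^3 \<Rightarrow> real"
  assumes hom: "\<And>t x. 0 \<le> t \<Longrightarrow> h (t *\<^sub>R x) = t * h x"
    and diff: "\<And>x. x \<noteq> 0 \<Longrightarrow> h differentiable (at x)"
    and cont: "continuous_on (sphere 0 1) \<theta>"
    and odd: "\<And>x. norm x = 1 \<Longrightarrow> \<theta> (- x) = - \<theta> x"
    and planes: "\<And>\<xi>. norm \<xi> = 1 \<Longrightarrow> \<theta> \<xi> = 0 \<Longrightarrow> \<exists>a. \<forall>x. \<xi> \<bullet> x = 0 \<longrightarrow> h x = a \<bullet> x"
  shows "\<exists>b. \<forall>x. h x = b \<bullet> x"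
proof -
  obtain p where p: "norm p = 1" "\<theta> p = 0"
    using odd_zero_on_great_circle[OF cont odd, of 0] by blast
  obtain q where q: "norm q = 1" "p \<bullet> q = 0" "\<theta> q = 0"
    using odd_zero_on_great_circle[OF cont odd, of p] by blast
  define w where "w = p \<times> q"
  have w: "norm w = 1" "p \<bullet> w = 0" "q \<bullet> w = 0"
    using cross_unit[OF p(1) q(1,2)] by (simp_all add: w_def dot_cross_self)
  have wp: "w \<times> p = q" and wq: "w \<times> q = - p"
    using p q cross_skew[of w p] cross_skew[of w q]
    by (simp_all add: w_def Lagrange norm_eq_1 inner_commute)
  have expand: "x = (x \<bullet> p) *\<^sub>R p + (x \<bullet> q) *\<^sub>R q + (x \<bullet> w) *\<^sub>R w" for x
    unfolding w_def by (rule orthonormal_expansion) (use p q in simp_all)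
  \<comment> \<open>The functional that agrees with \<open>h\<close> on the orthonormal basis \<open>p\<close>, \<open>q\<close>, \<open>w\<close>.\<close>
  define b where "b = h p *\<^sub>R p + h q *\<^sub>R q + h w *\<^sub>R w"
  define k where "k x = h x - b \<bullet> x" for x
  have kp: "k p = 0" and kq: "k q = 0" and kw: "k w = 0"
    using p q w by (simp_all add: k_def b_def inner_add_left inner_add_right norm_eq_1 inner_commute)
  have khom: "k (t *\<^sub>R x) = t * k x" if "0 \<le> t" for t x
    using hom[OF that] by (simp add: k_def algebra_simps)
  have planes: "\<exists>a. \<forall>x. \<xi> \<bullet> x = 0 \<longrightarrow> k x = a \<bullet> x" if "norm \<xi> = 1" "\<theta> \<xi> = 0" for \<xi>
  proof -
    obtain a where "\<forall>x. \<xi> \<bullet> x = 0 \<longrightarrow> h x = a \<bullet> x"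
      using planes \<open>norm \<xi> = 1\<close> \<open>\<theta> \<xi> = 0\<close> by blast
    then have "\<forall>x. \<xi> \<bullet> x = 0 \<longrightarrow> k x = (a - b) \<bullet> x"
      by (simp add: k_def inner_diff_left)
    then show ?thesis ..
  qed
  have zero: "k x = 0" if "norm \<xi> = 1" "\<theta> \<xi> = 0" "\<xi> \<bullet> v = 0" "\<xi> \<bullet> u = 0" "v \<times> u \<noteq> 0"
      "k v = 0" "k u = 0" "\<xi> \<bullet> x = 0" for \<xi> u v x
  proof -
    obtain a where "\<And>y. \<xi> \<bullet> y = 0 \<Longrightarrow> k y = a \<bullet> y"
      using planes \<open>norm \<xi> = 1\<close> \<open>\<theta> \<xi> = 0\<close> by blast
    then show ?thesis
      using linear_on_plane_eq_0[of \<xi> k a v u x] that by fastforce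
  qed
  have k_p: "k x = 0" if "p \<bullet> x = 0" for x
    by (rule zero[of p w q]) (use p q w wp wq kq kw that in auto)
  have k_q: "k x = 0" if "q \<bullet> x = 0" for x
    by (rule zero[of q w p]) (use p q w wp wq kp kw that in \<open>auto simp: inner_commute\<close>)
  have "k x = 0" for x
  proof (cases "\<exists>\<eta>. norm \<eta> = 1 \<and> \<theta> \<eta> = 0 \<and> \<eta> \<bullet> w \<noteq> 0")
    case True
    then obtain \<eta> where \<eta>: "norm \<eta> = 1" "\<theta> \<eta> = 0" "\<eta> \<bullet> w \<noteq> 0"
      by blast
    \<comment> \<open>If \<open>\<xi>\<close> is not in the plane of \<open>p\<close> and \<open>q\<close>, then \<open>\<xi>\<^sup>\<bottom>\<close> meets \<open>p\<^sup>\<bottom>\<close> and \<open>q\<^sup>\<bottom>\<close> in different lines.\<close>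
    have off: "k y = 0" if "norm \<xi> = 1" "\<theta> \<xi> = 0" "\<xi> \<bullet> w \<noteq> 0" "\<xi> \<bullet> y = 0" for \<xi> y
    proof (rule zero[of \<xi> "\<xi> \<times> p" "\<xi> \<times> q"])
      have "(\<xi> \<times> p) \<times> (\<xi> \<times> q) = (\<xi> \<bullet> w) *\<^sub>R \<xi>"
        by (simp add: w_def cross_cross_det dot_cross_self flip: dot_cross_det)
      then show "(\<xi> \<times> p) \<times> (\<xi> \<times> q) \<noteq> 0"
        using that by auto
    qed (use that k_p k_q in \<open>simp_all add: dot_cross_self\<close>)
    obtain \<xi> where \<xi>: "norm \<xi> = 1" "x \<bullet> \<xi> = 0" "\<theta> \<xi> = 0"
      using odd_zero_on_great_circle[OF cont odd] .
    show ?thesis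
    proof (cases "\<xi> \<bullet> w = 0")
      case False
      then show ?thesis
        using off[of \<xi> x] \<xi> by (simp add: inner_commute)
    next
      case True
      \<comment> \<open>Now \<open>\<xi>\<close> lies in the plane of \<open>p\<close> and \<open>q\<close>: combine \<open>\<eta>\<^sup>\<bottom>\<close> with whichever of \<open>p\<^sup>\<bottom>\<close> and \<open>q\<^sup>\<bottom>\<close>
        meets \<open>\<xi>\<^sup>\<bottom>\<close> in a line outside \<open>\<eta>\<^sup>\<bottom>\<close>.\<close>
      have tp: "\<xi> \<bullet> (p \<times> \<eta>) = - ((\<xi> \<bullet> q) * (\<eta> \<bullet> w))"
        and tq: "\<xi> \<bullet> (q \<times> \<eta>) = (\<xi> \<bullet> p) * (\<eta> \<bullet> w)"
      proof -
        have e: "\<xi> = (\<xi> \<bullet> p) *\<^sub>R p + (\<xi> \<bullet> q) *\<^sub>R q"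
          using expand[of \<xi>] True by simp
        have "\<xi> \<bullet> (p \<times> \<eta>) = (\<xi> \<bullet> q) * (q \<bullet> (p \<times> \<eta>))"
          by (subst e) (simp add: inner_add_left dot_cross_self)
        also have "q \<bullet> (p \<times> \<eta>) = - (\<eta> \<bullet> w)"
          by (metis cross_skew cross_triple inner_commute inner_minus_left w_def)
        finally show "\<xi> \<bullet> (p \<times> \<eta>) = - ((\<xi> \<bullet> q) * (\<eta> \<bullet> w))" by simp
        have "\<xi> \<bullet> (q \<times> \<eta>) = (\<xi> \<bullet> p) * (p \<bullet> (q \<times> \<eta>))"
          by (subst e) (simp add: inner_add_left dot_cross_self)
        also have "p \<bullet> (q \<times> \<eta>) = \<eta> \<bullet> w"
          by (metis cross_triple inner_commute w_def)
        finally show "\<xi> \<bullet> (q \<times> \<eta>) = (\<xi> \<bullet> p) * (\<eta> \<bullet> w)" .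
      qed
      have "\<xi> \<bullet> p \<noteq> 0 \<or> \<xi> \<bullet> q \<noteq> 0"
        using expand[of \<xi>] True \<xi> by auto
      then consider "\<xi> \<bullet> (p \<times> \<eta>) \<noteq> 0" | "\<xi> \<bullet> (q \<times> \<eta>) \<noteq> 0"
        using tp tq \<eta> by auto
      then show ?thesis
      proof cases
        case 1
        show ?thesis
        proof (rule zero[of \<xi> "\<xi> \<times> p" "\<xi> \<times> \<eta>"])
          show "(\<xi> \<times> p) \<times> (\<xi> \<times> \<eta>) \<noteq> 0"
            using 1 \<xi> by (auto simp: cross_cross_det dot_cross_self simp flip: dot_cross_det)
        qed (use \<xi> \<eta> k_p off[of \<eta>] in \<open>simp_all add: dot_cross_self inner_commute\<close>)
      next
        case 2
        show ?thesis
        proof (rule zero[of \<xi> "\<xi> \<times> q" "\<xi> \<times> \<eta>"])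
          show "(\<xi> \<times> q) \<times> (\<xi> \<times> \<eta>) \<noteq> 0"
            using 2 \<xi> by (auto simp: cross_cross_det dot_cross_self simp flip: dot_cross_det)
        qed (use \<xi> \<eta> k_q off[of \<eta>] in \<open>simp_all add: dot_cross_self inner_commute\<close>)
      qed
    qed
  next
    case False
    \<comment> \<open>The half circle from \<open>w\<close> to \<open>- w\<close> through \<open>u\<close> contains a zero of \<open>\<theta>\<close>. All
      zeros are now orthogonal to \<open>w\<close>, so it must be \<open>u\<close>.\<close>
    have circle: "\<theta> u = 0" if u: "norm u = 1" "w \<bullet> u = 0" for u
    proof -
      obtain t where t: "\<theta> (cos t *\<^sub>R w + sin t *\<^sub>R u) = 0" "0 \<le> t" "t \<le> pi"
        using odd_zero_on_half_circle[OF cont odd w(1) u] by blast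
      have "norm (cos t *\<^sub>R w + sin t *\<^sub>R u) = 1"
        by (rule norm_cos_sin_combination) (use w u in auto)
      then have "(cos t *\<^sub>R w + sin t *\<^sub>R u) \<bullet> w = 0"
        using False t by blast
      then have c: "cos t = 0"
        using u w by (auto simp: inner_add_left inner_commute[of u w])
      then have "sin t = 1"
        using t sin_ge_zero[of t] sin_zero_abs_cos_one[of t] sin_cos_squared_add[of t]
        by (simp add: power2_eq_1_iff)
      then show ?thesis
        using t c by simp
    qed
    have cyl: "k (s *\<^sub>R w + u) = k u" if u: "w \<bullet> u = 0" for s u
    proof (cases "u = 0")
      case True
      have "q \<bullet> (s *\<^sub>R w) = 0" "q \<bullet> 0 = 0"
        using w by simp_all
      then show ?thesis
        using k_q True by simp
    next
      case False
      define \<xi> where "\<xi> = (w \<times> u) /\<^sub>R norm (w \<times> u)"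
      have "w \<times> u \<noteq> 0"
        using False u w norm_and_cross_eq_0[of w u] by auto
      then have \<xi>: "norm \<xi> = 1" "w \<bullet> \<xi> = 0" "\<xi> \<bullet> u = 0" "\<xi> \<bullet> w = 0"
        by (simp_all add: \<xi>_def dot_cross_self)
      then obtain a where a: "\<And>y. \<xi> \<bullet> y = 0 \<Longrightarrow> k y = a \<bullet> y"
        using planes circle by blast
      then have "a \<bullet> w = 0"
        using kw \<xi> by simp
      then show ?thesis
        using a \<xi> by (simp add: inner_add_right)
    qed
    have "h differentiable (at w)"
      by (rule diff) (use w in auto)
    then have "k differentiable (at w)"
      unfolding k_def
      by (rule differentiable_diff) (rule bounded_linear_imp_differentiable[OF bounded_linear_inner_right])
    then obtain D where D: "(k has_derivative D) (at w)"
      by (auto simp: differentiable_def)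
    have lin: "linear D"
      using D has_derivative_linear by blast
    \<comment> \<open>Positive homogeneity determines the derivative along \<open>u\<close> from the right only; this suffices.\<close>
    have Dk: "D u = k u" if u: "w \<bullet> u = 0" for u
    proof -
      have "((\<lambda>t. w + t *\<^sub>R u) has_derivative (\<lambda>t. t *\<^sub>R u)) (at (0::real))"
        by (auto intro!: derivative_eq_intros)
      moreover have "(k has_derivative D) (at (w + (0::real) *\<^sub>R u))"
        using D by simp
      ultimately have "((\<lambda>t. k (w + t *\<^sub>R u)) has_derivative (\<lambda>t. D (t *\<^sub>R u))) (at 0)"
        by (rule has_derivative_compose)
      then have "((\<lambda>t. k (w + t *\<^sub>R u)) has_vector_derivative D u) (at 0)"
        by (simp add: has_vector_derivative_def linear_scale[OF lin])
      then have "((\<lambda>t. k (w + t *\<^sub>R u)) has_vector_derivative D u) (at 0 within {0..})"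
        by (rule has_vector_derivative_at_within)
      moreover have "((\<lambda>t. k (w + t *\<^sub>R u)) has_vector_derivative k u) (at 0 within {0..})"
      proof (rule has_vector_derivative_transform)
        show "((\<lambda>t. t * k u) has_vector_derivative k u) (at 0 within {0..})"
          by (auto intro!: derivative_eq_intros)
        show "k (w + t *\<^sub>R u) = t * k u" if "t \<in> {0..}" for t
          using cyl[of "t *\<^sub>R u" 1] khom[of t u] u that by simp
      qed simp
      ultimately show ?thesis
        by (intro vector_derivative_unique_within) (auto simp: at_within_Ici_at_right)
    qed
    have "w \<bullet> p = 0" "w \<bullet> q = 0"
      using w by (simp_all add: inner_commute)
    then have "D ((x \<bullet> p) *\<^sub>R p + (x \<bullet> q) *\<^sub>R q) = 0"
      using Dk kp kq by (simp add: linear_add[OF lin] linear_scale[OF lin])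
    moreover have "w \<bullet> ((x \<bullet> p) *\<^sub>R p + (x \<bullet> q) *\<^sub>R q) = 0"
      using \<open>w \<bullet> p = 0\<close> \<open>w \<bullet> q = 0\<close> by (simp add: inner_add_right)
    ultimately have "k ((x \<bullet> w) *\<^sub>R w + ((x \<bullet> p) *\<^sub>R p + (x \<bullet> q) *\<^sub>R q)) = 0"
      using cyl Dk by metis
    then show ?thesis
      using expand[of x] by (simp add: add.commute add.left_commute)
  qed
  then show ?thesis
    by (auto simp: k_def)
qed

section \<open>Rotations of an oriented plane\<close>

text \<open>For a unit vector \<open>\<xi>\<close> and a unit complex number \<open>c\<close>, the restriction of \<open>rot \<xi> c\<close> to the plane
orthogonal to \<open>\<xi>\<close> is the rotation by the argument of \<open>c\<close>, where \<open>\<xi>\<close> fixes the orientation. Unit complex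
numbers in place of angles make the rotation a single-valued parameter. Outside of this plane the
values of \<open>rot \<xi> c\<close> have no significance.\<close>
definition rot :: "real^3 \<Rightarrow> complex \<Rightarrow> real^3 \<Rightarrow> real^3" where
  "rot \<xi> c x = Re c *\<^sub>R x + Im c *\<^sub>R (\<xi> \<times> x)"

lemma rot_orthogonal: "\<xi> \<bullet> x = 0 \<Longrightarrow> \<xi> \<bullet> rot \<xi> c x = 0"
  by (simp add: rot_def inner_add_right dot_cross_self)

lemma rot_rot:
  assumes "norm \<xi> = 1" "\<xi> \<bullet> x = 0"
  shows "rot \<xi> c (rot \<xi> d x) = rot \<xi> (c * d) x"
proof -
  have "\<xi> \<times> (\<xi> \<times> x) = - x"
    using assms by (simp add: Lagrange norm_eq_1)
  then show ?thesis
    by (simp add: rot_def cross_add_right cross_mult_right algebra_simps)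
qed

lemma rot_1 [simp]: "rot \<xi> 1 x = x"
  by (simp add: rot_def)

lemma rot_of_real [simp]: "rot \<xi> (of_real r) x = r *\<^sub>R x"
  by (simp add: rot_def)

lemma rot_uminus_axis: "rot (- \<xi>) (cnj c) x = rot \<xi> c x"
  by (simp add: rot_def)

lemma inner_rot: "a \<bullet> rot \<xi> (cnj c) x = rot \<xi> c a \<bullet> x"
proof -
  have "a \<bullet> (\<xi> \<times> x) = - ((\<xi> \<times> a) \<bullet> x)"
    by (metis cross_skew cross_triple inner_commute inner_minus_left)
  then show ?thesis
    by (simp add: rot_def inner_add_left inner_diff_right)
qed

lemma norm_rot:
  assumes "norm \<xi> = 1" "norm c = 1" "\<xi> \<bullet> x = 0"
  shows "norm (rot \<xi> c x) = norm x"
proof -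
  have "rot \<xi> c x \<bullet> rot \<xi> c x = rot \<xi> (cnj c) (rot \<xi> c x) \<bullet> x"
    using inner_rot[of "rot \<xi> c x" \<xi> "cnj c" x] by simp
  also have "\<dots> = x \<bullet> x"
    using assms by (simp add: rot_rot mult.commute[of "cnj c"] flip: complex_norm_square)
  finally show ?thesis
    by (simp add: norm_eq)
qed

section \<open>The rotation angle as a continuous odd function\<close>

text \<open>Two congruences of \<open>F\<close> with \<open>G\<close> on the plane compose to a self-congruence of \<open>F\<close>.\<close>
lemma congruent_plane_angle_unique:
  fixes F G :: "real^3 \<Rightarrow> real"
  assumes \<xi>: "norm \<xi> = 1"
    and nosym: "\<And>c a. norm c = 1 \<Longrightarrow> \<xi> \<bullet> a = 0 \<Longrightarrow>
      (\<And>x. \<xi> \<bullet> x = 0 \<Longrightarrow> F (rot \<xi> c x) + a \<bullet> x = F x) \<Longrightarrow> c = 1"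
    and c: "norm c = 1" "\<xi> \<bullet> a = 0" "\<And>x. \<xi> \<bullet> x = 0 \<Longrightarrow> F (rot \<xi> c x) + a \<bullet> x = G x"
    and d: "norm d = 1" "\<xi> \<bullet> b = 0" "\<And>x. \<xi> \<bullet> x = 0 \<Longrightarrow> F (rot \<xi> d x) + b \<bullet> x = G x"
  shows "c = d"
proof -
  have dd: "d * cnj d = 1"
    using d by (simp flip: complex_norm_square)
  have "c * cnj d = 1"
  proof (rule nosym)
    show "norm (c * cnj d) = 1"
      using c d by (simp add: norm_mult)
    show "\<xi> \<bullet> rot \<xi> d (a - b) = 0"
      using c d by (simp add: rot_orthogonal inner_diff_right)
    fix x assume x: "\<xi> \<bullet> x = 0"
    define y where "y = rot \<xi> (cnj d) x"
    have y: "\<xi> \<bullet> y = 0" "rot \<xi> c y = rot \<xi> (c * cnj d) x" "rot \<xi> d y = x"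
      using \<xi> x dd by (simp_all add: y_def rot_orthogonal rot_rot)
    have "F (rot \<xi> c y) + a \<bullet> y = F (rot \<xi> d y) + b \<bullet> y"
      using c(3)[OF y(1)] d(3)[OF y(1)] by simp
    moreover have "rot \<xi> d (a - b) \<bullet> x = a \<bullet> y - b \<bullet> y"
      using inner_rot[of "a - b" \<xi> d x] by (simp add: y_def inner_diff_left)
    ultimately show "F (rot \<xi> (c * cnj d) x) + rot \<xi> d (a - b) \<bullet> x = F x"
      using y by simp
  qed
  then have "c * (d * cnj d) = d"
    by (metis mult.left_commute mult.right_neutral)
  then show ?thesis
    by (simp add: dd)
qed

text \<open>The translation vectors belonging to \<open>\<phi> \<xi>\<close> are bounded because \<open>F\<close> and \<open>G\<close> are bounded on the unit
sphere, so the triples of normal, rotation and translation form a compact set.\<close>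
lemma congruence_angle_continuous:
  fixes F G :: "real^3 \<Rightarrow> real"
  assumes cF: "continuous_on UNIV F" and cG: "continuous_on UNIV G"
    and nosym: "\<And>\<xi> c a. norm \<xi> = 1 \<Longrightarrow> norm c = 1 \<Longrightarrow> \<xi> \<bullet> a = 0 \<Longrightarrow>
      (\<And>x. \<xi> \<bullet> x = 0 \<Longrightarrow> F (rot \<xi> c x) + a \<bullet> x = F x) \<Longrightarrow> c = 1"
    and \<phi>: "\<And>\<xi>. norm \<xi> = 1 \<Longrightarrow> norm (\<phi> \<xi>) = 1 \<and>
      (\<exists>a. \<xi> \<bullet> a = 0 \<and> (\<forall>x. \<xi> \<bullet> x = 0 \<longrightarrow> F (rot \<xi> (\<phi> \<xi>) x) + a \<bullet> x = G x))"
  shows "continuous_on (sphere 0 1) \<phi>"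
proof -
  obtain B where B: "\<And>x. norm x = 1 \<Longrightarrow> \<bar>F x\<bar> \<le> B" "\<And>x. norm x = 1 \<Longrightarrow> \<bar>G x\<bar> \<le> B"
  proof -
    have "compact (F ` sphere 0 1)" "compact (G ` sphere 0 1)"
      by (rule compact_continuous_image[OF continuous_on_subset[OF cF]],
          use compact_sphere in auto)
        (rule compact_continuous_image[OF continuous_on_subset[OF cG]],
          use compact_sphere in auto)
    then have "bounded (F ` sphere 0 1 \<union> G ` sphere 0 1)"
      by (simp add: compact_imp_bounded)
    then show ?thesis
      using that unfolding bounded_iff by (force simp: image_iff)
  qed
  define K :: "((real^3) \<times> complex \<times> (real^3)) set" where
    "K = {(\<xi>, c, a). norm \<xi> = 1 \<and> norm c = 1 \<and> norm a \<le> 2 * B \<and> \<xi> \<bullet> a = 0 \<and>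
      (\<forall>w. F (rot \<xi> c (\<xi> \<times> w)) + a \<bullet> (\<xi> \<times> w) = G (\<xi> \<times> w))}"
  \<comment> \<open>Writing the vectors orthogonal to \<open>\<xi>\<close> as \<open>\<xi> \<times> w\<close> makes the range of quantification
    independent of \<open>\<xi>\<close>, so that \<open>K\<close> is visibly closed.\<close>
  have on_plane: "(\<forall>w. P (\<xi> \<times> w)) \<longleftrightarrow> (\<forall>x. \<xi> \<bullet> x = 0 \<longrightarrow> P x)" if "norm \<xi> = 1"
    for P and \<xi> :: "real^3"
  proof -
    have "\<xi> \<times> (x \<times> \<xi>) = x" if "\<xi> \<bullet> x = 0" for x
      using that \<open>norm \<xi> = 1\<close> by (simp add: Lagrange norm_eq_1)
    then show ?thesis
      by (metis dot_cross_self(1))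
  qed
  have K: "(\<xi>, c, a) \<in> K \<longleftrightarrow> norm \<xi> = 1 \<and> norm c = 1 \<and> norm a \<le> 2 * B \<and> \<xi> \<bullet> a = 0 \<and>
      (\<forall>x. \<xi> \<bullet> x = 0 \<longrightarrow> F (rot \<xi> c x) + a \<bullet> x = G x)" for \<xi> c a
    unfolding K_def mem_Collect_eq case_prod_conv
    using on_plane[of \<xi> "\<lambda>x. F (rot \<xi> c x) + a \<bullet> x = G x"] by blast
  have "compact K"
  proof -
    have "continuous_on UNIV (\<lambda>p::(real^3) \<times> complex \<times> (real^3). rot (fst p) (fst (snd p)) (fst p \<times> w))"
      "continuous_on UNIV (\<lambda>p::(real^3) \<times> complex \<times> (real^3). fst p \<times> w)" for w
      unfolding rot_def by (intro continuous_intros continuous_on_cross)+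
    then have "closed K"
      unfolding K_def case_prod_unfold
      by (intro closed_Collect_conj closed_Collect_all closed_Collect_eq closed_Collect_le
          continuous_intros continuous_on_compose2[OF cF] continuous_on_compose2[OF cG]) auto
    moreover have "K \<subseteq> Sigma (sphere 0 1) (\<lambda>_. Sigma (sphere 0 1) (\<lambda>_. cball 0 (2 * B)))"
      by (auto simp: K_def)
    ultimately show ?thesis
      by (metis bounded_Times bounded_cball bounded_sphere bounded_subset compact_eq_bounded_closed)
  qed
  show ?thesis
  proof (rule continuous_on_unique_selection)
    show "compact ((\<lambda>(\<xi>, c, a). (\<xi>, c)) ` K)"
      unfolding case_prod_unfold by (intro compact_continuous_image continuous_intros \<open>compact K\<close>)
    show "fst ` (\<lambda>(\<xi>, c, a). (\<xi>, c)) ` K \<subseteq> sphere 0 1"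
      by (auto simp: K)
    show "(\<xi>, \<phi> \<xi>) \<in> (\<lambda>(\<xi>, c, a). (\<xi>, c)) ` K" if "\<xi> \<in> sphere 0 1" for \<xi>
    proof -
      have \<xi>: "norm \<xi> = 1" using that by simp
      then obtain a where a: "norm (\<phi> \<xi>) = 1" "\<xi> \<bullet> a = 0"
          "\<And>x. \<xi> \<bullet> x = 0 \<Longrightarrow> F (rot \<xi> (\<phi> \<xi>) x) + a \<bullet> x = G x"
        using \<phi> by blast
      have "norm a \<le> 2 * B"
      proof (cases "a = 0")
        case True
        then show ?thesis using B(1)[OF \<xi>] by simp
      next
        case False
        define x where "x = a /\<^sub>R norm a"
        have x: "norm x = 1" "\<xi> \<bullet> x = 0" "a \<bullet> x = norm a"
          using False a by (simp_all add: x_def power2_norm_eq_inner[symmetric] power2_eq_square)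
        have "norm a = G x - F (rot \<xi> (\<phi> \<xi>) x)"
          using a(3)[OF x(2)] x by simp
        then show ?thesis
          using B(1)[of "rot \<xi> (\<phi> \<xi>) x"] B(2)[OF x(1)] norm_rot[OF \<xi> a(1) x(2)] x by simp
      qed
      then have "(\<xi>, \<phi> \<xi>, a) \<in> K"
        using \<xi> a by (simp add: K)
      then show ?thesis
        by (rule rev_image_eqI) simp
    qed
    show "c = \<phi> \<xi>" if c: "(\<xi>, c) \<in> (\<lambda>(\<xi>, c, a). (\<xi>, c)) ` K" for \<xi> c
    proof -
      obtain a where a: "(\<xi>, c, a) \<in> K"
        using c by auto
      then have \<xi>: "norm \<xi> = 1"
        by (simp add: K)
      obtain b where b: "\<xi> \<bullet> b = 0" "\<forall>x. \<xi> \<bullet> x = 0 \<longrightarrow> F (rot \<xi> (\<phi> \<xi>) x) + b \<bullet> x = G x"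
        using \<phi>[OF \<xi>] by blast
      show ?thesis
      proof (rule congruent_plane_angle_unique[where F = F and G = G and a = a and b = b])
        show "c' = 1" if "norm c' = 1" "\<xi> \<bullet> a' = 0"
            "\<And>x. \<xi> \<bullet> x = 0 \<Longrightarrow> F (rot \<xi> c' x) + a' \<bullet> x = F x" for c' a'
          by (rule nosym[OF \<xi> that])
      qed (use a b \<xi> \<phi>[OF \<xi>] in \<open>auto simp: K\<close>)
    qed
  qed
qed

text \<open>A continuous unit complex function lifts to an angle \<open>\<tau>\<close>; the hypothesis on antipodes makes
\<open>\<tau> x + \<tau> (- x)\<close> a constant \<open>2 * pi * n\<close>. Subtracting \<open>pi * n\<close> from \<open>\<tau>\<close> leaves an odd function and the
sign \<open>\<epsilon> = (-1)\<^sup>n\<close>.\<close>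
lemma odd_angle_lift:
  fixes \<phi> :: "'a::euclidean_space \<Rightarrow> complex"
  assumes dim: "3 \<le> DIM('a)" and cont: "continuous_on (sphere 0 1) \<phi>"
    and unit: "\<And>x. norm x = 1 \<Longrightarrow> norm (\<phi> x) = 1"
    and cnj: "\<And>x. norm x = 1 \<Longrightarrow> \<phi> (- x) = cnj (\<phi> x)"
  obtains \<theta> :: "'a \<Rightarrow> real" and \<epsilon> :: real where
    "continuous_on (sphere 0 1) \<theta>" "\<And>x. norm x = 1 \<Longrightarrow> \<theta> (- x) = - \<theta> x"
    "\<epsilon> = 1 \<or> \<epsilon> = -1" "\<And>x. norm x = 1 \<Longrightarrow> \<phi> x = of_real \<epsilon> * cis (\<theta> x)"
proof -
  have "\<phi> \<in> sphere 0 1 \<rightarrow> - {0}"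
    using unit by force
  then obtain g where g: "continuous_on (sphere 0 1) g" "\<And>x. norm x = 1 \<Longrightarrow> \<phi> x = exp (g x)"
    using Borsukian_sphere[OF dim, of 0 1] cont
    unfolding Borsukian_continuous_logarithm by (metis dist_0_norm mem_sphere)
  define \<tau> where "\<tau> x = Im (g x)" for x
  have \<tau>: "\<phi> x = cis (\<tau> x)" if "norm x = 1" for x
    using g(2)[OF that] unit[OF that] by (simp add: \<tau>_def exp_eq_polar norm_mult)
  have c\<tau>: "continuous_on (sphere 0 1) \<tau>"
    unfolding \<tau>_def by (intro continuous_intros g)
  have period: "\<exists>n::int. \<tau> x + \<tau> (- x) = 2 * pi * n" if "norm x = 1" for x
  proof -
    have "cis (\<tau> x + \<tau> (- x)) = \<phi> x * cnj (\<phi> x)"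
      using \<tau>[of x] \<tau>[of "- x"] cnj[of x] that by (simp add: cis_mult)
    also have "\<dots> = 1"
      using unit[OF that] by (simp flip: complex_norm_square)
    finally have "cos (\<tau> x + \<tau> (- x)) = 1"
      by (metis cis.simps(1) one_complex.simps(1))
    then show ?thesis
      by (auto simp: cos_one_2pi_int mult_ac)
  qed
  have "(\<lambda>x. \<tau> x + \<tau> (- x)) constant_on sphere 0 1"
  proof (rule continuous_discrete_range_constant)
    show "connected (sphere (0::'a) 1)"
      using dim by (simp add: connected_sphere)
    show "continuous_on (sphere 0 1) (\<lambda>x. \<tau> x + \<tau> (- x))"
      by (intro continuous_intros c\<tau> continuous_on_compose2[OF c\<tau>]) auto
    fix x :: 'a assume "x \<in> sphere 0 1"
    then obtain n :: int where n: "\<tau> x + \<tau> (- x) = 2 * pi * n"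
      using period[of x] by auto
    have "2 * pi \<le> norm ((\<tau> y + \<tau> (- y)) - (\<tau> x + \<tau> (- x)))"
      if y: "y \<in> sphere 0 1" "\<tau> y + \<tau> (- y) \<noteq> \<tau> x + \<tau> (- x)" for y
    proof -
      obtain m :: int where m: "\<tau> y + \<tau> (- y) = 2 * pi * m"
        using period[of y] y by auto
      have "m \<noteq> n"
        using y n m by auto
      then have "1 \<le> \<bar>real_of_int (m - n)\<bar>"
        by linarith
      then show ?thesis
        by (simp add: n m abs_mult flip: right_diff_distrib)
    qed
    then show "\<exists>e>0. \<forall>y. y \<in> sphere 0 1 \<and> \<tau> y + \<tau> (- y) \<noteq> \<tau> x + \<tau> (- x) \<longrightarrow>
        e \<le> norm ((\<tau> y + \<tau> (- y)) - (\<tau> x + \<tau> (- x)))"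
      by (intro exI[of _ "2 * pi"]) auto
  qed
  then obtain s where s: "\<And>x. norm x = 1 \<Longrightarrow> \<tau> x + \<tau> (- x) = s"
    by (force simp: constant_on_def)
  obtain e :: 'a where "norm e = 1"
    using vector_choose_size[of 1] by auto
  then obtain n :: int where n: "s = 2 * pi * n"
    using period s by metis
  have cis_n: "cis (pi * n) = of_real (cos (pi * n))"
    by (simp add: complex_eq_iff sin_zero_iff_int2 mult.commute)
  have "cos (pi * n) = 1 \<or> cos (pi * n) = -1"
    using sin_zero_abs_cos_one[of "pi * n"] by (simp add: sin_zero_iff_int2 mult.commute abs_if split: if_splits)
  moreover have "\<phi> x = of_real (cos (pi * n)) * cis (\<tau> x - pi * n)" if "norm x = 1" for x
    unfolding cis_n[symmetric] cis_mult using \<tau>[OF that] by simp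
  moreover have "continuous_on (sphere 0 1) (\<lambda>x. \<tau> x - pi * n)"
    by (intro continuous_intros c\<tau>)
  moreover have "\<tau> (- x) - pi * n = - (\<tau> x - pi * n)" if "norm x = 1" for x
    using s[OF that] n by simp
  ultimately show ?thesis
    using that[of "\<lambda>x. \<tau> x - pi * n" "cos (pi * n)"] by blast
qed

section \<open>The three-dimensional case\<close>

proposition congruent_planes_real3:
  fixes F G :: "real^3 \<Rightarrow> real"
  assumes cF: "continuous_on UNIV F" and cG: "continuous_on UNIV G"
    and homF: "\<And>t x. 0 \<le> t \<Longrightarrow> F (t *\<^sub>R x) = t * F x"
    and homG: "\<And>t x. 0 \<le> t \<Longrightarrow> G (t *\<^sub>R x) = t * G x"
    and dF: "\<And>x. x \<noteq> 0 \<Longrightarrow> F differentiable (at x)"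
    and dG: "\<And>x. x \<noteq> 0 \<Longrightarrow> G differentiable (at x)"
    and cong: "\<And>\<xi>. norm \<xi> = 1 \<Longrightarrow> \<exists>c a. norm c = 1 \<and> \<xi> \<bullet> a = 0 \<and>
      (\<forall>x. \<xi> \<bullet> x = 0 \<longrightarrow> F (rot \<xi> c x) + a \<bullet> x = G x)"
    and nosym: "\<And>\<xi> c a. norm \<xi> = 1 \<Longrightarrow> norm c = 1 \<Longrightarrow> \<xi> \<bullet> a = 0 \<Longrightarrow>
      (\<And>x. \<xi> \<bullet> x = 0 \<Longrightarrow> F (rot \<xi> c x) + a \<bullet> x = F x) \<Longrightarrow> c = 1"
  shows "\<exists>\<epsilon> b. (\<epsilon> = 1 \<or> \<epsilon> = -1) \<and> (\<forall>x. G x = F (\<epsilon> *\<^sub>R x) + b \<bullet> x)"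
proof -
  obtain \<phi> where \<phi>: "\<And>\<xi>. norm \<xi> = 1 \<Longrightarrow> norm (\<phi> \<xi>) = 1 \<and>
      (\<exists>a. \<xi> \<bullet> a = 0 \<and> (\<forall>x. \<xi> \<bullet> x = 0 \<longrightarrow> F (rot \<xi> (\<phi> \<xi>) x) + a \<bullet> x = G x))"
    using cong by metis
  have cont: "continuous_on (sphere 0 1) \<phi>"
    by (rule congruence_angle_continuous[OF cF cG nosym \<phi>])
  have "\<phi> (- \<xi>) = cnj (\<phi> \<xi>)" if \<xi>: "norm \<xi> = 1" for \<xi>
  proof -
    have m\<xi>: "norm (- \<xi>) = 1"
      using \<xi> by simp
    obtain a where a: "\<xi> \<bullet> a = 0" "\<And>x. \<xi> \<bullet> x = 0 \<Longrightarrow> F (rot \<xi> (\<phi> \<xi>) x) + a \<bullet> x = G x"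
      using \<phi>[OF \<xi>] by blast
    obtain b where b: "- \<xi> \<bullet> b = 0"
        "\<And>x. - \<xi> \<bullet> x = 0 \<Longrightarrow> F (rot (- \<xi>) (\<phi> (- \<xi>)) x) + b \<bullet> x = G x"
      using \<phi>[OF m\<xi>] by blast
    show ?thesis
    proof (rule congruent_plane_angle_unique[where F = F and G = G and a = b and b = a])
      show "c' = 1" if "norm c' = 1" "- \<xi> \<bullet> a' = 0"
          "\<And>x. - \<xi> \<bullet> x = 0 \<Longrightarrow> F (rot (- \<xi>) c' x) + a' \<bullet> x = F x" for c' a'
        by (rule nosym[OF m\<xi> that])
      show "F (rot (- \<xi>) (cnj (\<phi> \<xi>)) x) + a \<bullet> x = G x" if "- \<xi> \<bullet> x = 0" for x
        using a that by (simp add: rot_uminus_axis)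
    qed (use \<phi>[OF \<xi>] \<phi>[OF m\<xi>] m\<xi> a b in auto)
  qed
  then obtain \<theta> and \<epsilon> :: real where \<theta>: "continuous_on (sphere 0 1) \<theta>"
      "\<And>x. norm x = 1 \<Longrightarrow> \<theta> (- x) = - \<theta> x"
    and \<epsilon>: "\<epsilon> = 1 \<or> \<epsilon> = -1" and \<phi>\<theta>: "\<And>x. norm x = 1 \<Longrightarrow> \<phi> x = of_real \<epsilon> * cis (\<theta> x)"
    using odd_angle_lift[of \<phi>] cont \<phi> by auto
  have "\<exists>b. \<forall>x. G x - F (\<epsilon> *\<^sub>R x) = b \<bullet> x"
  proof (rule homogeneous_linear_if_linear_on_planes[OF _ _ \<theta>])
    show "G (t *\<^sub>R x) - F (\<epsilon> *\<^sub>R t *\<^sub>R x) = t * (G x - F (\<epsilon> *\<^sub>R x))" if "0 \<le> t" for t x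
      using homG[OF that, of x] homF[OF that, of "\<epsilon> *\<^sub>R x"] by (simp add: algebra_simps)
    show "(\<lambda>x. G x - F (\<epsilon> *\<^sub>R x)) differentiable (at x)" if "x \<noteq> 0" for x
    proof -
      have "F differentiable (at (\<epsilon> *\<^sub>R x))"
        using that \<epsilon> by (intro dF) auto
      then have "(\<lambda>x. F (\<epsilon> *\<^sub>R x)) differentiable (at x)"
        by (intro differentiable_compose[of F "\<lambda>x. \<epsilon> *\<^sub>R x"] derivative_intros)
      then show ?thesis
        using dG[OF that] by (intro derivative_intros)
    qed
    show "\<exists>a. \<forall>x. \<xi> \<bullet> x = 0 \<longrightarrow> G x - F (\<epsilon> *\<^sub>R x) = a \<bullet> x" if \<xi>: "norm \<xi> = 1" "\<theta> \<xi> = 0" for \<xi>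
    proof -
      obtain a where "\<forall>x. \<xi> \<bullet> x = 0 \<longrightarrow> F (rot \<xi> (\<phi> \<xi>) x) + a \<bullet> x = G x"
        using \<phi>[OF \<xi>(1)] by blast
      then have "\<forall>x. \<xi> \<bullet> x = 0 \<longrightarrow> G x - F (\<epsilon> *\<^sub>R x) = a \<bullet> x"
        using \<phi>\<theta>[OF \<xi>(1)] \<xi>(2) by (auto simp: algebra_simps)
      then show ?thesis ..
    qed
  qed
  then obtain b where "\<And>x. G x - F (\<epsilon> *\<^sub>R x) = b \<bullet> x"
    by blast
  then have "\<forall>x. G x = F (\<epsilon> *\<^sub>R x) + b \<bullet> x"
    by (simp add: algebra_simps)
  then show ?thesis
    using \<epsilon> by blast
qed

section \<open>Positively homogeneous extension of a support function\<close>

text \<open>The extension of degree one of a function on the unit sphere; at the origin it vanishes, whatever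
value \<open>f\<close> has there.\<close>
definition homogeneous_extension :: "('a::real_normed_vector \<Rightarrow> real) \<Rightarrow> 'a \<Rightarrow> real" where
  "homogeneous_extension f x = norm x * f (x /\<^sub>R norm x)"

lemma homogeneous_extension_unit: "norm u = 1 \<Longrightarrow> homogeneous_extension f u = f u"
  by (simp add: homogeneous_extension_def)

lemma homogeneous_extension_scale:
  "0 \<le> t \<Longrightarrow> homogeneous_extension f (t *\<^sub>R x) = t * homogeneous_extension f x"
proof -
  assume "0 \<le> t"
  moreover have "(t *\<^sub>R x) /\<^sub>R norm (t *\<^sub>R x) = x /\<^sub>R norm x" if "0 < t"
  proof -
    have "inverse (t * norm x) * t = inverse (norm x)"
      using that by simp
    then show ?thesis
      using that by (simp only: norm_scaleR abs_of_pos scaleR_scaleR)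
  qed
  ultimately show ?thesis
    unfolding homogeneous_extension_def by (cases "t = 0") (auto simp del: scaleR_scaleR)
qed

lemma homogeneous_extension_differentiable:
  fixes f :: "'a::real_inner \<Rightarrow> real"
  assumes f: "C2_on_sphere f" and "x \<noteq> 0"
  shows "homogeneous_extension f differentiable (at x)"
proof -
  define u where "u = x /\<^sub>R norm x"
  have "u \<in> sphere 0 1"
    using \<open>x \<noteq> 0\<close> by (simp add: u_def)
  then have "\<exists>U F. open U \<and> u \<in> U \<and> C2_on F U \<and> (\<forall>v\<in>U \<inter> sphere 0 1. F v = f v)"
    using f unfolding C2_on_sphere_def by (rule bspec[rotated])
  then obtain U F where U: "open U" "u \<in> U" "C2_on F U" "\<forall>v\<in>U \<inter> sphere 0 1. F v = f v"
    by (elim exE conjE)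
  then obtain F' where "(F has_derivative blinfun_apply (F' u)) (at u)"
    unfolding C2_on_def by blast
  then have dF: "F differentiable (at (x /\<^sub>R norm x))"
    unfolding u_def by (rule differentiableI)
  have n: "norm differentiable (at x)"
    by (rule differentiable_norm_at[OF \<open>x \<noteq> 0\<close>])
  then have "(\<lambda>y. inverse (norm y)) differentiable (at x)"
    using \<open>x \<noteq> 0\<close> by (intro differentiable_inverse) auto
  then have "(\<lambda>y. y /\<^sub>R norm y) differentiable (at x)"
    using differentiable_ident by (rule differentiable_scaleR)
  with dF have "(\<lambda>y. F (y /\<^sub>R norm y)) differentiable (at x)"
    by (intro differentiable_compose[of F "\<lambda>y. y /\<^sub>R norm y"])
  with n have "(\<lambda>y. norm y * F (y /\<^sub>R norm y)) differentiable (at x)"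
    by (rule differentiable_mult)
  then obtain D where D: "((\<lambda>y. norm y * F (y /\<^sub>R norm y)) has_derivative D) (at x)"
    by (auto simp: differentiable_def)
  have "(homogeneous_extension f has_derivative D) (at x)"
  proof (rule has_derivative_transform_within_open[OF D])
    have "continuous_on (- {0}) (\<lambda>y::'a. y /\<^sub>R norm y)"
      by (auto intro!: continuous_intros)
    then show "open (- {0} \<inter> (\<lambda>y::'a. y /\<^sub>R norm y) -` U)"
      by (rule continuous_open_preimage) (use U in auto)
    show "x \<in> - {0} \<inter> (\<lambda>y::'a. y /\<^sub>R norm y) -` U"
      using U \<open>x \<noteq> 0\<close> by (simp add: u_def)
    show "norm y * F (y /\<^sub>R norm y) = homogeneous_extension f y"
      if "y \<in> - {0} \<inter> (\<lambda>y::'a. y /\<^sub>R norm y) -` U" for y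
      using that bspec[OF U(4), of "y /\<^sub>R norm y"] by (simp add: homogeneous_extension_def)
  qed
  then show ?thesis
    by (auto simp: differentiable_def)
qed

lemma homogeneous_extension_continuous:
  fixes f :: "'a::euclidean_space \<Rightarrow> real"
  assumes f: "C2_on_sphere f"
  shows "continuous_on UNIV (homogeneous_extension f)"
proof -
  have nz: "isCont (homogeneous_extension f) x" if "x \<noteq> 0" for x
    using homogeneous_extension_differentiable[OF f that] by (rule differentiable_imp_continuous_within)
  have "continuous_on (sphere 0 1) (homogeneous_extension f)"
    by (rule continuous_at_imp_continuous_on) (auto intro!: nz)
  then have "bounded (homogeneous_extension f ` sphere 0 1)"
    by (intro compact_imp_bounded compact_continuous_image) auto
  then obtain B where B: "\<And>u. norm u = 1 \<Longrightarrow> \<bar>f u\<bar> \<le> B"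
    using homogeneous_extension_unit[of _ f]
    by (metis bounded_iff dist_0_norm image_eqI mem_sphere real_norm_def)
  have bound: "norm (homogeneous_extension f x) \<le> norm x * B" for x
    using B[of "x /\<^sub>R norm x"]
    by (cases "x = 0") (auto simp: homogeneous_extension_def abs_mult intro!: mult_left_mono)
  have "((\<lambda>x::'a. norm x * B) \<longlongrightarrow> 0) (at 0)"
    by (auto intro!: tendsto_eq_intros)
  then have "(homogeneous_extension f \<longlongrightarrow> 0) (at 0)"
    by (rule Lim_null_comparison[rotated]) (use bound in auto)
  then have "isCont (homogeneous_extension f) 0"
    by (simp add: isCont_def homogeneous_extension_def)
  then show ?thesis
    using nz by (metis continuous_at_imp_continuous_on)
qed

section \<open>Rotations of a plane in higher dimensions\<close>

text \<open>Reflection in the hyperplane orthogonal to \<open>v\<close>, for a unit vector \<open>v\<close>. The rotations of a plane,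
extended by the identity on its orthogonal complement, are the products of two such reflections
with \<open>v\<close> in the plane.\<close>
definition mirror :: "'a::real_inner \<Rightarrow> 'a \<Rightarrow> 'a" where
  "mirror v x = x - (2 * (x \<bullet> v)) *\<^sub>R v"

lemma linear_mirror: "linear (mirror v)"
  by (auto simp: mirror_def inner_add_left algebra_simps intro!: linearI)

lemma mirror_mirror: "norm v = 1 \<Longrightarrow> mirror v (mirror v x) = x"
  by (simp add: mirror_def inner_diff_left norm_eq_1 algebra_simps)

lemma mirror_orthogonal: "x \<bullet> v = 0 \<Longrightarrow> mirror v x = x"
  by (simp add: mirror_def)

lemma orthogonal_transformation_mirror:
  assumes "norm v = 1"
  shows "orthogonal_transformation (mirror v)"
  unfolding orthogonal_transformation_def
proof (intro conjI allI linear_mirror)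
  fix x y
  have "v \<bullet> v = 1"
    using assms by (simp add: norm_eq_1)
  then show "mirror v x \<bullet> mirror v y = x \<bullet> y"
    by (simp add: mirror_def inner_diff_left inner_diff_right inner_commute[of v y])
qed

lemma mirror_image:
  assumes "norm v = 1" "subspace \<alpha>" "v \<in> \<alpha>"
  shows "mirror v ` \<alpha> = \<alpha>"
proof -
  have sub: "mirror v x \<in> \<alpha>" if "x \<in> \<alpha>" for x
    using that assms by (simp add: mirror_def subspace_diff subspace_scale)
  then show ?thesis
    using mirror_mirror[OF assms(1)] by (metis image_eqI image_subsetI subset_antisym subsetI)
qed

lemma det_mirror:
  fixes v :: "real^'n"
  assumes v: "norm v = 1"
  shows "det (matrix (mirror v)) = -1"
proof -
  define k where "k = (undefined :: 'n)"
  obtain T :: "real^'n \<Rightarrow> real^'n" where T: "orthogonal_transformation T" "T (axis k 1) = v"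
    by (rule orthogonal_transformation_exists_1[of "axis k 1" v]) (use v in auto)
  have lT: "linear T"
    using T orthogonal_transformation_linear by blast
  have "mirror v \<circ> T = T \<circ> mirror (axis k 1)"
  proof
    fix x
    have "T x \<bullet> v = x \<bullet> axis k 1"
      using T unfolding orthogonal_transformation_def by metis
    then show "(mirror v \<circ> T) x = (T \<circ> mirror (axis k 1)) x"
      by (simp add: mirror_def T(2) linear_diff[OF lT] linear_scale[OF lT])
  qed
  then have "matrix (mirror v) ** matrix T = matrix T ** matrix (mirror (axis k 1))"
    by (metis lT linear_mirror matrix_compose)
  then have "det (matrix (mirror v)) * det (matrix T) = det (matrix T) * det (matrix (mirror (axis k 1 :: real^'n)))"
    by (metis det_mul)
  moreover have "det (matrix T) \<noteq> 0"
    using T(1) det_orthogonal_matrix orthogonal_transformation_matrix by fastforce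
  moreover have "det (matrix (mirror (axis k 1 :: real^'n))) = -1"
  proof -
    have entry: "matrix (mirror (axis k 1 :: real^'n)) $ i $ j =
        (if i = j then if i = k then -1 else 1 else 0)" for i j
      by (auto simp: matrix_def mirror_def inner_axis_axis) (auto simp: axis_def)
    have "det (matrix (mirror (axis k 1 :: real^'n))) = (\<Prod>i\<in>UNIV. if i = k then -1 else 1)"
      by (subst det_diagonal) (simp_all add: entry)
    also have "\<dots> = -1"
      by (simp add: prod.delta)
    finally show ?thesis .
  qed
  ultimately show ?thesis
    by (metis mult.commute mult_right_cancel)
qed

lemma in_span_pair: "v \<in> span {p, q} \<longleftrightarrow> (\<exists>s t. v = s *\<^sub>R p + t *\<^sub>R q)"
proof -
  have "v \<in> span {p, q} \<longleftrightarrow> (\<exists>s t. v - s *\<^sub>R p = t *\<^sub>R q)"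
    by (auto simp: span_breakdown_eq)
  then show ?thesis
    by (simp add: algebra_simps)
qed

lemma adjoint_orthogonal_transformation:
  fixes \<psi> :: "'a::euclidean_space \<Rightarrow> 'a"
  assumes "orthogonal_transformation \<psi>"
  shows "adjoint \<psi> (\<psi> v) = v"
proof -
  have "x \<bullet> adjoint \<psi> (\<psi> v) = x \<bullet> v" for x
    using assms adjoint_works[of \<psi> x "\<psi> v"] by (simp add: orthogonal_transformation_def)
  then show ?thesis
    using vector_eq_ldot by blast
qed

text \<open>The mirror line is at the angle \<open>t / 2\<close> from \<open>p\<close>, and \<open>v\<close> is its normal.\<close>
lemma mirror_half_angle:
  fixes p q :: "'a::real_inner" and t :: real
  assumes "norm p = 1" "norm q = 1" "p \<bullet> q = 0"
  defines "v \<equiv> cos (t / 2) *\<^sub>R q - sin (t / 2) *\<^sub>R p"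
  shows "norm v = 1" "mirror v p = cos t *\<^sub>R p + sin t *\<^sub>R q"
    "mirror v q = sin t *\<^sub>R p - cos t *\<^sub>R q"
proof -
  have pq: "p \<bullet> p = 1" "q \<bullet> q = 1" "q \<bullet> p = 0" "p \<bullet> q = 0"
    using assms by (simp_all add: norm_eq_1 inner_commute)
  show "norm v = 1"
    using norm_cos_sin_combination[of q "- p" "t / 2"] assms pq by (simp add: v_def)
  have c: "cos t = 1 - 2 * (sin (t / 2))\<^sup>2" "cos t = 2 * (cos (t / 2))\<^sup>2 - 1"
    and s: "sin t = 2 * sin (t / 2) * cos (t / 2)"
    using cos_double_sin[of "t / 2"] cos_double_cos[of "t / 2"] sin_double[of "t / 2"] by simp_all
  have "mirror v p = (1 - 2 * (sin (t / 2))\<^sup>2) *\<^sub>R p + (2 * sin (t / 2) * cos (t / 2)) *\<^sub>R q"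
    by (simp add: mirror_def v_def pq inner_diff_right algebra_simps power2_eq_square)
  then show "mirror v p = cos t *\<^sub>R p + sin t *\<^sub>R q"
    by (simp flip: c s)
  have "mirror v q = (2 * sin (t / 2) * cos (t / 2)) *\<^sub>R p - (2 * (cos (t / 2))\<^sup>2 - 1) *\<^sub>R q"
    by (simp add: mirror_def v_def pq inner_diff_right algebra_simps power2_eq_square)
  then show "mirror v q = sin t *\<^sub>R p - cos t *\<^sub>R q"
    by (simp flip: c s)
qed

lemma rotation_of_plane_exists:
  fixes p q :: "real^'n"
  assumes p: "norm p = 1" and q: "norm q = 1" and pq: "p \<bullet> q = 0" and c: "norm c = 1"
  obtains \<psi> where "rotation_of (span {p, q}) \<psi>"
    "adjoint \<psi> p = Re c *\<^sub>R p + Im c *\<^sub>R q" "adjoint \<psi> q = Re c *\<^sub>R q - Im c *\<^sub>R p"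
proof -
  obtain t where t: "c = cis t"
    using c by (metis complex_norm_eq_1_exp cis_conv_exp)
  define v where "v = cos (t / 2) *\<^sub>R q - sin (t / 2) *\<^sub>R p"
  note v = mirror_half_angle[OF p q pq, of t, folded v_def]
  define \<psi> where "\<psi> = mirror q \<circ> mirror v"
  have v_in: "v \<in> span {p, q}" and q_in: "q \<in> span {p, q}"
    unfolding v_def by (intro span_diff span_scale span_base; simp)+
  have orth: "orthogonal_transformation \<psi>"
    unfolding \<psi>_def
    by (intro orthogonal_transformation_compose orthogonal_transformation_mirror v q)
  have "\<psi> ` span {p, q} = span {p, q}"
    unfolding \<psi>_def image_comp[symmetric]
    using mirror_image[OF v(1) subspace_span v_in] mirror_image[OF q subspace_span q_in] by simp
  moreover have "\<psi> x = x" if "x \<in> orthogonal_comp (span {p, q})" for x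
  proof -
    have "x \<bullet> v = 0" "x \<bullet> q = 0"
      using that v_in q_in by (auto simp: orthogonal_comp_def orthogonal_def inner_commute)
    then show ?thesis
      by (simp add: \<psi>_def mirror_orthogonal)
  qed
  moreover have "det (matrix \<psi>) = 1"
    unfolding \<psi>_def matrix_compose[OF linear_mirror linear_mirror] det_mul
    using det_mirror[OF v(1)] det_mirror[OF q] by simp
  ultimately have rot: "rotation_of (span {p, q}) \<psi>"
    using orth by (auto simp: rotation_of_def)
  have "adjoint \<psi> x = mirror v (mirror q x)" for x
    using adjoint_orthogonal_transformation[OF orth, of "mirror v (mirror q x)"] v(1) q
    by (simp add: \<psi>_def mirror_mirror)
  moreover have "mirror q p = p" "mirror q q = - q"
    using q pq by (simp_all add: mirror_def norm_eq_1 algebra_simps scaleR_2)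
  ultimately have "adjoint \<psi> p = cos t *\<^sub>R p + sin t *\<^sub>R q" "adjoint \<psi> q = cos t *\<^sub>R q - sin t *\<^sub>R p"
    using v by (simp_all add: linear_neg[OF linear_mirror])
  then show ?thesis
    using that rot t by simp
qed

text \<open>An orthogonal map of the plane is a rotation or a reflection; the determinant condition excludes
reflections.\<close>
lemma rotation_of_plane_form:
  fixes p q :: "real^'n"
  assumes p: "norm p = 1" and q: "norm q = 1" and pq: "p \<bullet> q = 0"
    and rot: "rotation_of (span {p, q}) \<psi>"
  obtains c where "norm c = 1"
    "adjoint \<psi> p = Re c *\<^sub>R p + Im c *\<^sub>R q" "adjoint \<psi> q = Re c *\<^sub>R q - Im c *\<^sub>R p"
proof -
  have orth: "orthogonal_transformation \<psi>" and im: "\<psi> ` span {p, q} = span {p, q}"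
    and comp: "\<And>x. x \<in> orthogonal_comp (span {p, q}) \<Longrightarrow> \<psi> x = x" and det: "det (matrix \<psi>) = 1"
    using rot by (auto simp: rotation_of_def)
  have lin: "linear \<psi>" and inner: "\<And>x y. \<psi> x \<bullet> \<psi> y = x \<bullet> y"
    using orth by (auto simp: orthogonal_transformation_def)
  have pp: "p \<bullet> p = 1" "q \<bullet> q = 1" "q \<bullet> p = 0"
    using p q pq by (simp_all add: norm_eq_1 inner_commute)
  have "\<psi> p \<in> span {p, q}" "\<psi> q \<in> span {p, q}"
    using im by (auto simp: span_base)
  then obtain x y z w where \<psi>p: "\<psi> p = x *\<^sub>R p + y *\<^sub>R q" and \<psi>q: "\<psi> q = z *\<^sub>R p + w *\<^sub>R q"
    unfolding in_span_pair by blast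
  have xy: "x * x + y * y = 1" and zw: "z * z + w * w = 1" and xz: "x * z + y * w = 0"
    using inner[of p p] inner[of q q] inner[of p q]
    by (simp_all add: \<psi>p \<psi>q inner_add_left inner_add_right pp pq mult.commute)
  \<comment> \<open>The determinant of \<open>\<psi>\<close> on the plane.\<close>
  define k where "k = x * w - y * z"
  have wz: "w = k * x" "z = - (k * y)"
  proof -
    have "w = (x * x + y * y) * w - y * (x * z + y * w)" "z = (x * x + y * y) * z - x * (x * z + y * w)"
      by (simp_all add: xy xz)
    then show "w = k * x" "z = - (k * y)"
      by (simp_all add: k_def algebra_simps)
  qed
  have "k * k = (x * x + y * y) * (z * z + w * w) - (x * z + y * w) * (x * z + y * w)"
    by (simp add: k_def algebra_simps)
  then have "k * k = 1"
    by (simp add: xy zw xz)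
  then consider "k = 1" | "k = -1"
    by (metis square_eq_1_iff)
  then show ?thesis
  proof cases
    case 1
    have "adjoint \<psi> (\<psi> (x *\<^sub>R p - y *\<^sub>R q)) = x *\<^sub>R p - y *\<^sub>R q"
      "adjoint \<psi> (\<psi> (y *\<^sub>R p + x *\<^sub>R q)) = y *\<^sub>R p + x *\<^sub>R q"
      by (rule adjoint_orthogonal_transformation[OF orth])+
    moreover have "\<psi> (x *\<^sub>R p - y *\<^sub>R q) = (x * x + y * y) *\<^sub>R p"
      "\<psi> (y *\<^sub>R p + x *\<^sub>R q) = (x * x + y * y) *\<^sub>R q"
      using wz 1 by (simp_all add: linear_diff[OF lin] linear_add[OF lin] linear_scale[OF lin]
          \<psi>p \<psi>q algebra_simps)
    ultimately have "adjoint \<psi> p = x *\<^sub>R p - y *\<^sub>R q" "adjoint \<psi> q = y *\<^sub>R p + x *\<^sub>R q"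
      by (simp_all add: xy)
    moreover have "norm (Complex x (- y)) = 1"
      using xy by (simp add: cmod_def power2_eq_square)
    ultimately show ?thesis
      using that[of "Complex x (- y)"] by (simp add: algebra_simps)
  next
    case 2
    have "norm (Complex x y) = 1"
      using xy by (simp add: cmod_def power2_eq_square)
    then obtain t where "Complex x y = cis t"
      by (metis complex_norm_eq_1_exp cis_conv_exp)
    then have t: "x = cos t" "y = sin t"
      by (auto simp: complex_eq_iff)
    define v where "v = cos (t / 2) *\<^sub>R q - sin (t / 2) *\<^sub>R p"
    note v = mirror_half_angle[OF p q pq, of t, folded v_def]
    have "\<psi> u = mirror v u" for u
    proof -
      define r where "r = u - (u \<bullet> p) *\<^sub>R p - (u \<bullet> q) *\<^sub>R q"
      have u: "u = (u \<bullet> p) *\<^sub>R p + (u \<bullet> q) *\<^sub>R q + r"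
        by (simp add: r_def)
      have r: "p \<bullet> r = 0" "q \<bullet> r = 0"
        by (simp_all add: r_def inner_diff_right pp pq inner_commute)
      then have "r \<in> orthogonal_comp (span {p, q})"
        by (auto simp: orthogonal_comp_def orthogonal_def in_span_pair inner_add_left)
      then have "\<psi> r = r"
        by (rule comp)
      moreover have "mirror v r = r"
        using r by (intro mirror_orthogonal) (simp add: v_def inner_diff_right inner_commute)
      moreover have "\<psi> p = mirror v p" "\<psi> q = mirror v q"
        using v t wz 2 \<psi>p \<psi>q by simp_all
      ultimately show ?thesis
        by (subst (1 2) u) (simp add: linear_add[OF lin] linear_scale[OF lin]
            linear_add[OF linear_mirror] linear_scale[OF linear_mirror])
    qed
    then have "\<psi> = mirror v" ..
    then show ?thesis
      using det det_mirror[OF v(1)] by simp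
  qed
qed

section \<open>Planes inside an isometric copy of three-space\<close>

text \<open>The image of the plane orthogonal to \<open>\<xi>\<close> has an orthonormal basis \<open>p\<close>, \<open>q\<close> that matches the
orientation given by \<open>\<xi>\<close>: a linear map acts on \<open>p\<close> and \<open>q\<close> as the rotation by \<open>c\<close> iff it corresponds
to \<open>rot \<xi> c\<close>.\<close>
lemma isometry_plane:
  fixes e :: "real^3 \<Rightarrow> real^'n"
  assumes lin: "linear e" and inner: "\<And>x y. e x \<bullet> e y = x \<bullet> y" and \<xi>: "norm \<xi> = 1"
  obtains p q where "norm p = 1" "norm q = 1" "p \<bullet> q = 0" "e ` {x. \<xi> \<bullet> x = 0} = span {p, q}"
    "\<And>\<psi> c. linear \<psi> \<Longrightarrow>
      \<psi> p = Re c *\<^sub>R p + Im c *\<^sub>R q \<and> \<psi> q = Re c *\<^sub>R q - Im c *\<^sub>R p \<longleftrightarrow>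
      (\<forall>x. \<xi> \<bullet> x = 0 \<longrightarrow> \<psi> (e x) = e (rot \<xi> c x))"
proof -
  obtain p where p: "norm p = 1" "\<xi> \<bullet> p = 0"
    using unit_orthogonal_exists .
  define q where "q = \<xi> \<times> p"
  have q: "norm q = 1" "\<xi> \<bullet> q = 0" "p \<bullet> q = 0" "q \<bullet> p = 0"
    using cross_unit[OF \<xi> p] by (simp_all add: q_def dot_cross_self)
  have \<xi>q: "\<xi> \<times> q = - p"
    using \<xi> p by (simp add: q_def Lagrange norm_eq_1)
  have "p \<times> q = \<xi>"
    using p by (simp add: q_def Lagrange norm_eq_1 inner_commute)
  then have "p \<times> q \<noteq> 0" "\<xi> \<noteq> 0"
    using \<xi> by auto
  then have plane: "\<xi> \<bullet> x = 0 \<longleftrightarrow> (\<exists>s t. x = s *\<^sub>R p + t *\<^sub>R q)" for x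
    using plane_spanned[OF \<open>\<xi> \<noteq> 0\<close> p(2) q(2), of x] p(2) q(2)
    by (metis add.right_neutral inner_add_right inner_scaleR_right mult_zero_right)
  note le = linear_add[OF lin] linear_scale[OF lin] linear_neg[OF lin] linear_diff[OF lin]
  have rp: "e (rot \<xi> c p) = Re c *\<^sub>R e p + Im c *\<^sub>R e q"
    and rq: "e (rot \<xi> c q) = Re c *\<^sub>R e q - Im c *\<^sub>R e p" for c
    using \<xi>q by (simp_all add: rot_def le flip: q_def)
  have rot: "e (rot \<xi> c (s *\<^sub>R p + t *\<^sub>R q)) = s *\<^sub>R e (rot \<xi> c p) + t *\<^sub>R e (rot \<xi> c q)" for c s t
    by (simp add: rot_def le cross_add_right cross_mult_right algebra_simps)
  show ?thesis
  proof (rule that[of "e p" "e q"])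
    show "norm (e p) = 1" "norm (e q) = 1" "e p \<bullet> e q = 0"
      using p q by (simp_all add: norm_eq_1 inner)
    show "e ` {x. \<xi> \<bullet> x = 0} = span {e p, e q}"
      by (force simp: plane in_span_pair le)
    fix \<psi> :: "real^'n \<Rightarrow> real^'n" and c assume \<psi>: "linear \<psi>"
    show "\<psi> (e p) = Re c *\<^sub>R e p + Im c *\<^sub>R e q \<and> \<psi> (e q) = Re c *\<^sub>R e q - Im c *\<^sub>R e p \<longleftrightarrow>
      (\<forall>x. \<xi> \<bullet> x = 0 \<longrightarrow> \<psi> (e x) = e (rot \<xi> c x))"
    proof
      assume "\<psi> (e p) = Re c *\<^sub>R e p + Im c *\<^sub>R e q \<and> \<psi> (e q) = Re c *\<^sub>R e q - Im c *\<^sub>R e p"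
      then have "\<psi> (e p) = e (rot \<xi> c p)" "\<psi> (e q) = e (rot \<xi> c q)"
        by (simp_all add: rp rq)
      then show "\<forall>x. \<xi> \<bullet> x = 0 \<longrightarrow> \<psi> (e x) = e (rot \<xi> c x)"
        by (auto simp: plane rot) (simp add: le linear_add[OF \<psi>] linear_scale[OF \<psi>])
    next
      assume "\<forall>x. \<xi> \<bullet> x = 0 \<longrightarrow> \<psi> (e x) = e (rot \<xi> c x)"
      then show "\<psi> (e p) = Re c *\<^sub>R e p + Im c *\<^sub>R e q \<and> \<psi> (e q) = Re c *\<^sub>R e q - Im c *\<^sub>R e p"
        using p q by (simp add: rp rq)
    qed
  qed
qed

lemma dim_span_orthonormal_pair:
  fixes p q :: "'a::euclidean_space"
  assumes "norm p = 1" "norm q = 1" "p \<bullet> q = 0"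
  shows "dim (span {p, q}) = 2"
proof -
  have "p \<noteq> q" "p \<noteq> 0" "q \<noteq> 0"
    using assms by (auto simp: norm_eq_1)
  have "independent {p, q}"
    by (rule pairwise_orthogonal_independent)
      (use assms \<open>p \<noteq> 0\<close> \<open>q \<noteq> 0\<close> in \<open>auto simp: pairwise_def orthogonal_def inner_commute\<close>)
  then show ?thesis
    using \<open>p \<noteq> q\<close> by (simp add: dim_eq_card_independent)
qed

lemma orthonormal_pair_of_plane:
  fixes \<alpha> :: "'a::euclidean_space set"
  assumes "subspace \<alpha>" "dim \<alpha> = 2"
  obtains p q where "norm p = 1" "norm q = 1" "p \<bullet> q = 0" "span {p, q} = \<alpha>"
proof -
  obtain B where B: "B \<subseteq> \<alpha>" "pairwise orthogonal B" "\<And>x. x \<in> B \<Longrightarrow> norm x = 1"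
      "card B = dim \<alpha>" "span B = \<alpha>"
    using orthonormal_basis_subspace[OF \<open>subspace \<alpha>\<close>] by metis
  then obtain p q where "B = {p, q}" "p \<noteq> q"
    using assms by (auto simp: card_2_iff)
  then show ?thesis
    using B that[of p q] by (auto simp: pairwise_def orthogonal_def)
qed

lemma superspace_exists:
  fixes S :: "'a::euclidean_space set"
  assumes "dim S \<le> k" "k \<le> DIM('a)"
  shows "\<exists>V. subspace V \<and> S \<subseteq> V \<and> dim V = k"
  using assms
proof (induction k rule: dec_induct)
  case base
  then show ?case
    by (intro exI[of _ "span S"]) (auto simp: span_superset)
next
  case (step m)
  then obtain V where V: "subspace V" "S \<subseteq> V" "dim V = m"
    by auto
  then have "V \<noteq> UNIV"
    using step.prems by auto
  then obtain z where "z \<notin> V"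
    by auto
  then have "dim (insert z V) = Suc m"
    using V by (simp add: dim_insert span_eq_iff[THEN iffD2])
  then show ?case
    using V by (intro exI[of _ "span (insert z V)"]) (auto intro: span_base)
qed

section \<open>Passing from planes to the whole space\<close>

text \<open>On \<open>S\<close>, the function \<open>G\<close> differs from \<open>x \<mapsto> F (\<epsilon> x)\<close> by a linear functional. Here \<open>\<epsilon>\<close> is
\<open>1\<close> or \<open>-1\<close>, and for support functions the functional stands for a translation.\<close>
definition agree_mod_linear_on ::
  "('a::real_inner \<Rightarrow> real) \<Rightarrow> ('a \<Rightarrow> real) \<Rightarrow> real \<Rightarrow> 'a set \<Rightarrow> bool" where
  "agree_mod_linear_on F G \<epsilon> S \<longleftrightarrow> (\<exists>b. \<forall>x\<in>S. G x = F (\<epsilon> *\<^sub>R x) + b \<bullet> x)"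

lemma agree_mod_linear_on_subset:
  "agree_mod_linear_on F G \<epsilon> V \<Longrightarrow> S \<subseteq> V \<Longrightarrow> agree_mod_linear_on F G \<epsilon> S"
  unfolding agree_mod_linear_on_def by blast

text \<open>Were the sign \<open>1\<close> wrong for a plane \<open>\<alpha>\<close> and the sign \<open>-1\<close> wrong for a plane \<open>\<beta>\<close>, then a plane
spanned by \<open>x \<in> \<alpha>\<close> and \<open>y \<in> \<beta>\<close> would have both signs: one from a three-dimensional space
containing \<open>\<alpha>\<close> and \<open>y\<close>, the other from one containing \<open>\<beta>\<close> and \<open>x\<close>.\<close>
lemma common_sign:
  fixes F G :: "'a::euclidean_space \<Rightarrow> real"
  assumes dim: "3 \<le> DIM('a)"
    and space: "\<And>V. subspace V \<Longrightarrow> dim V = 3 \<Longrightarrow>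
      agree_mod_linear_on F G 1 V \<or> agree_mod_linear_on F G (-1) V"
    and plane: "\<And>\<alpha>. subspace \<alpha> \<Longrightarrow> dim \<alpha> = 2 \<Longrightarrow>
      \<not> (agree_mod_linear_on F G 1 \<alpha> \<and> agree_mod_linear_on F G (-1) \<alpha>)"
  obtains \<epsilon> where "\<epsilon> = 1 \<or> \<epsilon> = -1"
    "\<And>\<alpha>. subspace \<alpha> \<Longrightarrow> dim \<alpha> = 2 \<Longrightarrow> agree_mod_linear_on F G \<epsilon> \<alpha>"
proof (rule ccontr)
  assume "\<not> thesis"
  then have "\<exists>\<alpha>. subspace \<alpha> \<and> dim \<alpha> = 2 \<and> \<not> agree_mod_linear_on F G 1 \<alpha>"
    "\<exists>\<beta>. subspace \<beta> \<and> dim \<beta> = 2 \<and> \<not> agree_mod_linear_on F G (-1) \<beta>"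
    using that[of 1] that[of "-1"] by blast+
  then obtain \<alpha> \<beta> where \<alpha>: "subspace \<alpha>" "dim \<alpha> = 2" "\<not> agree_mod_linear_on F G 1 \<alpha>"
    and \<beta>: "subspace \<beta>" "dim \<beta> = 2" "\<not> agree_mod_linear_on F G (-1) \<beta>"
    by blast
  have "\<not> \<alpha> \<subseteq> {0}"
    using \<alpha> dim_eq_0[of \<alpha>] by auto
  then obtain x where x: "x \<in> \<alpha>" "x \<noteq> 0"
    by blast
  have "dim (span {x}) \<le> 1"
    using dim_le_card'[of "{x}"] by simp
  then have "\<not> \<beta> \<subseteq> span {x}"
    using dim_subset[of \<beta> "span {x}"] \<beta> by auto
  then obtain y where y: "y \<in> \<beta>" "y \<notin> span {x}"
    by blast
  have three: "dim (insert z \<gamma>) \<le> 3" if "dim \<gamma> = 2" for z and \<gamma> :: "'a set"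
    using that by (simp add: dim_insert)
  obtain V where V: "subspace V" "insert y \<alpha> \<subseteq> V" "dim V = 3"
    using superspace_exists[OF three[OF \<alpha>(2)] dim] by blast
  obtain W where W: "subspace W" "insert x \<beta> \<subseteq> W" "dim W = 3"
    using superspace_exists[OF three[OF \<beta>(2)] dim] by blast
  have "agree_mod_linear_on F G (-1) V"
    using space[OF V(1,3)] \<alpha>(3) V(2) agree_mod_linear_on_subset by blast
  moreover have "agree_mod_linear_on F G 1 W"
    using space[OF W(1,3)] \<beta>(3) W(2) agree_mod_linear_on_subset by blast
  moreover have "span {x, y} \<subseteq> V" "span {x, y} \<subseteq> W"
    by (rule span_minimal; use V W x y in auto)+
  moreover have "dim (span {x, y}) = 2"
  proof -
    have "dim (insert y {x}) = 2"
      using y x by (simp add: dim_insert)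
    then show ?thesis
      by (simp add: insert_commute)
  qed
  ultimately show False
    using plane[of "span {x, y}"] agree_mod_linear_on_subset by blast
qed

lemma inner_if_linear_on_planes:
  fixes H :: "'a::euclidean_space \<Rightarrow> real"
  assumes dim: "2 \<le> DIM('a)"
    and H: "\<And>\<alpha>. subspace \<alpha> \<Longrightarrow> dim \<alpha> = 2 \<Longrightarrow> \<exists>b. \<forall>x\<in>\<alpha>. H x = b \<bullet> x"
  shows "\<exists>b. \<forall>x. H x = b \<bullet> x"
proof -
  have pair: "\<exists>b. \<forall>z\<in>span {x, y}. H z = b \<bullet> z" for x y
  proof -
    have "dim {x, y} \<le> card {x, y}" "card {x, y} \<le> 2"
      by (simp_all add: dim_le_card' card_insert_le_m1)
    then obtain \<alpha> where \<alpha>: "subspace \<alpha>" "{x, y} \<subseteq> \<alpha>" "dim \<alpha> = 2"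
      using superspace_exists[OF _ dim, of "{x, y}"] by auto
    then show ?thesis
      using H span_minimal by (metis subsetD)
  qed
  have lin: "linear H"
  proof (rule linearI)
    fix x y
    obtain b where "\<forall>z\<in>span {x, y}. H z = b \<bullet> z"
      using pair by blast
    moreover have "x \<in> span {x, y}" "y \<in> span {x, y}" "x + y \<in> span {x, y}"
      by (simp_all add: span_base span_add)
    ultimately show "H (x + y) = H x + H y"
      by (simp add: inner_add_right)
  next
    fix x and r :: real
    obtain b where "\<forall>z\<in>span {x, x}. H z = b \<bullet> z"
      using pair by blast
    moreover have "x \<in> span {x, x}" "r *\<^sub>R x \<in> span {x, x}"
      by (simp_all add: span_base span_scale)
    ultimately show "H (r *\<^sub>R x) = r *\<^sub>R H x"
      by simp
  qed
  have "H x = adjoint H 1 \<bullet> x" for x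
    using adjoint_works[OF lin, of x 1] by (simp add: inner_commute)
  then show ?thesis
    by blast
qed

section \<open>Hedgehogs with directly congruent projections\<close>

text \<open>If both signs occurred, the rotation of the plane by \<open>pi\<close> would be a symmetry of the projection.\<close>
lemma congruence_sign_unique:
  fixes f :: "real^'n \<Rightarrow> real"
  assumes \<alpha>: "subspace \<alpha>" "dim \<alpha> = 2"
    and nosym: "\<not> direct_rigid_motion_symmetry (hedgehog \<alpha> f)"
  shows "\<not> (agree_mod_linear_on (homogeneous_extension f) G 1 \<alpha> \<and>
    agree_mod_linear_on (homogeneous_extension f) G (-1) \<alpha>)"
proof
  assume "agree_mod_linear_on (homogeneous_extension f) G 1 \<alpha> \<and>
    agree_mod_linear_on (homogeneous_extension f) G (-1) \<alpha>"
  then obtain b c where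
    b: "\<And>x. x \<in> \<alpha> \<Longrightarrow> G x = homogeneous_extension f x + b \<bullet> x" and
    c: "\<And>x. x \<in> \<alpha> \<Longrightarrow> G x = homogeneous_extension f (- x) + c \<bullet> x"
    unfolding agree_mod_linear_on_def by (metis scaleR_minus1_left scaleR_one)
  obtain p q where p: "norm p = 1" and q: "norm q = 1" and pq: "p \<bullet> q = 0" and span: "span {p, q} = \<alpha>"
    using orthonormal_pair_of_plane[OF \<alpha>] by blast
  obtain \<psi> where \<psi>: "rotation_of \<alpha> \<psi>" "adjoint \<psi> p = - p" "adjoint \<psi> q = - q"
    using rotation_of_plane_exists[OF p q pq, of "-1"] span by auto
  have orth: "orthogonal_transformation \<psi>"
    using \<psi> by (simp add: rotation_of_def)
  then have lin: "linear (adjoint \<psi>)"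
    by (intro adjoint_linear orthogonal_transformation_linear)
  have neg: "adjoint \<psi> u = - u" if "u \<in> \<alpha>" for u
    using that \<psi> unfolding span[symmetric] in_span_pair
    by (auto simp: linear_add[OF lin] linear_scale[OF lin])
  have "\<psi> \<noteq> id"
  proof
    assume "\<psi> = id"
    then have "- p = p"
      using adjoint_orthogonal_transformation[OF orth, of p] \<psi>(2) by simp
    then have "- (p \<bullet> p) = p \<bullet> p"
      by (metis inner_minus_left)
    then show False
      using p by (simp add: norm_eq_1)
  qed
  \<comment> \<open>The orthogonal projection of \<open>c - b\<close> onto \<open>\<alpha>\<close>; a translation vector has to lie in \<open>\<alpha>\<close>.\<close>
  define a where "a = ((c - b) \<bullet> p) *\<^sub>R p + ((c - b) \<bullet> q) *\<^sub>R q"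
  have a: "a \<bullet> u = c \<bullet> u - b \<bullet> u" if "u \<in> \<alpha>" for u
    using that p q pq unfolding span[symmetric] in_span_pair
    by (auto simp: a_def norm_eq_1 inner_add_left inner_add_right inner_diff_left inner_commute[of q p] algebra_simps)
  have "a \<in> \<alpha>"
    unfolding span[symmetric] in_span_pair a_def by blast
  moreover have "f (adjoint \<psi> u) + a \<bullet> u = f u" if "u \<in> unit_sphere \<alpha>" for u
  proof -
    have u: "u \<in> \<alpha>" "norm u = 1"
      using that by (auto simp: unit_sphere_def)
    then show ?thesis
      using a[of u] b[of u] c[of u] neg[of u] homogeneous_extension_unit[of u f]
        homogeneous_extension_unit[of "- u" f] by simp
  qed
  ultimately show False
    using nosym \<psi>(1) \<open>\<psi> \<noteq> id\<close> unfolding direct_rigid_motion_symmetry_iff by blast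
qed

lemma congruent_on_embedded_space:
  fixes f g :: "real^'n \<Rightarrow> real" and e :: "real^3 \<Rightarrow> real^'n"
  assumes f: "C2_on_sphere f" and g: "C2_on_sphere g"
    and cong: "\<And>\<alpha>. subspace \<alpha> \<Longrightarrow> dim \<alpha> = 2 \<Longrightarrow> directly_congruent (hedgehog \<alpha> f) (hedgehog \<alpha> g)"
    and nosym: "\<And>\<alpha>. subspace \<alpha> \<Longrightarrow> dim \<alpha> = 2 \<Longrightarrow> \<not> direct_rigid_motion_symmetry (hedgehog \<alpha> f)"
    and lin: "linear e" and inner: "\<And>x y. e x \<bullet> e y = x \<bullet> y"
  obtains \<epsilon> where "\<epsilon> = 1 \<or> \<epsilon> = -1"
    "agree_mod_linear_on (homogeneous_extension f) (homogeneous_extension g) \<epsilon> (range e)"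
proof -
  define F where "F x = homogeneous_extension f (e x)" for x
  define G where "G x = homogeneous_extension g (e x)" for x
  have norm_e: "norm (e x) = norm x" for x
    by (simp add: norm_eq inner)
  have homF: "F (t *\<^sub>R x) = t * F x" and homG: "G (t *\<^sub>R x) = t * G x" if "0 \<le> t" for t x
    using that by (simp_all add: F_def G_def linear_scale[OF lin] homogeneous_extension_scale)
  have cont_e: "continuous_on UNIV e"
    using lin by (simp add: linear_continuous_on linear_conv_bounded_linear)
  have diff: "(\<lambda>x. homogeneous_extension h (e x)) differentiable (at x)"
    if "C2_on_sphere h" "x \<noteq> 0" for h x
  proof -
    have "e x \<noteq> 0"
      using that norm_e[of x] by auto
    then have "homogeneous_extension h differentiable (at (e x))"
      by (rule homogeneous_extension_differentiable[OF that(1)])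
    then show ?thesis
      by (rule differentiable_compose) (rule linear_imp_differentiable[OF lin])
  qed
  have extend: "P (rot \<xi> c x) + a \<bullet> x = Q x"
    if P: "\<And>t x. 0 \<le> t \<Longrightarrow> P (t *\<^sub>R x) = t * P x" and Q: "\<And>t x. 0 \<le> t \<Longrightarrow> Q (t *\<^sub>R x) = t * Q x"
      and unit: "\<And>u. norm u = 1 \<Longrightarrow> \<xi> \<bullet> u = 0 \<Longrightarrow> P (rot \<xi> c u) + a \<bullet> u = Q u" and "\<xi> \<bullet> x = 0"
    for P Q :: "real^3 \<Rightarrow> real" and \<xi> c a x
  proof (cases "x = 0")
    case True
    then show ?thesis
      using P[of 0 0] Q[of 0 0] by (simp add: rot_def)
  next
    case False
    define u where "u = x /\<^sub>R norm x"
    have x: "x = norm x *\<^sub>R u" "norm u = 1" "\<xi> \<bullet> u = 0"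
      using False \<open>\<xi> \<bullet> x = 0\<close> by (simp_all add: u_def)
    have "rot \<xi> c x = norm x *\<^sub>R rot \<xi> c u"
      by (subst x(1)) (simp add: rot_def cross_mult_right scaleR_add_right mult.commute)
    then have "P (rot \<xi> c x) + a \<bullet> x = norm x * (P (rot \<xi> c u) + a \<bullet> u)"
      using P[of "norm x" "rot \<xi> c u"] x(1) by (metis distrib_left inner_scaleR_right norm_ge_zero)
    also have "\<dots> = Q x"
      using unit[OF x(2,3)] Q[of "norm x" u] x(1) by simp
    finally show ?thesis .
  qed
  have "\<exists>\<epsilon> b. (\<epsilon> = 1 \<or> \<epsilon> = -1) \<and> (\<forall>x. G x = F (\<epsilon> *\<^sub>R x) + b \<bullet> x)"
  proof (rule congruent_planes_real3[OF _ _ homF homG])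
    show "continuous_on UNIV F" "continuous_on UNIV G"
      unfolding F_def G_def
      using continuous_on_compose2[OF homogeneous_extension_continuous[OF f] cont_e]
        continuous_on_compose2[OF homogeneous_extension_continuous[OF g] cont_e] by auto
    show "F differentiable (at x)" "G differentiable (at x)" if "x \<noteq> 0" for x
      using diff[OF f that] diff[OF g that] by (simp_all add: F_def[abs_def] G_def[abs_def])
  next
    fix \<xi> :: "real^3" assume \<xi>: "norm \<xi> = 1"
    let ?\<alpha> = "e ` {x. \<xi> \<bullet> x = 0}"
    obtain p q where p: "norm p = 1" and q: "norm q = 1" and pq: "p \<bullet> q = 0"
      and span: "?\<alpha> = span {p, q}"
      and form: "\<And>\<psi> c. linear \<psi> \<Longrightarrow> \<psi> p = Re c *\<^sub>R p + Im c *\<^sub>R q \<and> \<psi> q = Re c *\<^sub>R q - Im c *\<^sub>R p \<longleftrightarrow>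
      (\<forall>x. \<xi> \<bullet> x = 0 \<longrightarrow> \<psi> (e x) = e (rot \<xi> c x))"
      by (rule isometry_plane[OF lin inner \<xi>]) (rule that; assumption)
    have \<alpha>: "subspace ?\<alpha>" "dim ?\<alpha> = 2"
      unfolding span using dim_span_orthonormal_pair[OF p q pq] by simp_all
    have adj: "linear (adjoint \<psi>)" if "rotation_of ?\<alpha> \<psi>" for \<psi>
      using that unfolding rotation_of_def
      by (intro adjoint_linear orthogonal_transformation_linear) auto
    obtain \<psi> a where \<psi>: "rotation_of ?\<alpha> \<psi>" and "a \<in> ?\<alpha>"
      and fg: "\<And>u. u \<in> unit_sphere ?\<alpha> \<Longrightarrow> f (adjoint \<psi> u) + a \<bullet> u = g u"
      using cong[OF \<alpha>] unfolding directly_congruent_iff by blast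
    then obtain a' where a': "a = e a'" "\<xi> \<bullet> a' = 0"
      by auto
    obtain c where c: "norm c = 1" "adjoint \<psi> p = Re c *\<^sub>R p + Im c *\<^sub>R q"
        "adjoint \<psi> q = Re c *\<^sub>R q - Im c *\<^sub>R p"
      using rotation_of_plane_form[OF p q pq, of \<psi>] \<psi> unfolding span by blast
    then have rot: "\<And>x. \<xi> \<bullet> x = 0 \<Longrightarrow> adjoint \<psi> (e x) = e (rot \<xi> c x)"
      using form[OF adj[OF \<psi>], of c] by simp
    have "F (rot \<xi> c x) + a' \<bullet> x = G x" if "\<xi> \<bullet> x = 0" for x
    proof (rule extend[OF homF homG _ that])
      fix u assume u: "norm u = 1" "\<xi> \<bullet> u = 0"
      then have "e u \<in> unit_sphere ?\<alpha>"
        by (auto simp: unit_sphere_def norm_e)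
      then show "F (rot \<xi> c u) + a' \<bullet> u = G u"
        using fg[of "e u"] rot[OF u(2)] u norm_rot[OF \<xi> c(1) u(2)]
        by (simp add: F_def G_def homogeneous_extension_unit norm_e a' inner)
    qed
    then show "\<exists>c a. norm c = 1 \<and> \<xi> \<bullet> a = 0 \<and> (\<forall>x. \<xi> \<bullet> x = 0 \<longrightarrow> F (rot \<xi> c x) + a \<bullet> x = G x)"
      using c(1) a'(2) by blast
  next
    fix \<xi> a :: "real^3" and c :: complex
    assume \<xi>: "norm \<xi> = 1" and c: "norm c = 1" and a: "\<xi> \<bullet> a = 0"
      and sym: "\<And>x. \<xi> \<bullet> x = 0 \<Longrightarrow> F (rot \<xi> c x) + a \<bullet> x = F x"
    let ?\<alpha> = "e ` {x. \<xi> \<bullet> x = 0}"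
    obtain p q where p: "norm p = 1" and q: "norm q = 1" and pq: "p \<bullet> q = 0"
      and span: "?\<alpha> = span {p, q}"
      and form: "\<And>\<psi> c. linear \<psi> \<Longrightarrow> \<psi> p = Re c *\<^sub>R p + Im c *\<^sub>R q \<and> \<psi> q = Re c *\<^sub>R q - Im c *\<^sub>R p \<longleftrightarrow>
      (\<forall>x. \<xi> \<bullet> x = 0 \<longrightarrow> \<psi> (e x) = e (rot \<xi> c x))"
      by (rule isometry_plane[OF lin inner \<xi>]) (rule that; assumption)
    have \<alpha>: "subspace ?\<alpha>" "dim ?\<alpha> = 2"
      unfolding span using dim_span_orthonormal_pair[OF p q pq] by simp_all
    obtain \<psi> where \<psi>: "rotation_of ?\<alpha> \<psi>" "adjoint \<psi> p = Re c *\<^sub>R p + Im c *\<^sub>R q"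
        "adjoint \<psi> q = Re c *\<^sub>R q - Im c *\<^sub>R p"
      using rotation_of_plane_exists[OF p q pq c] unfolding span by blast
    have orth: "orthogonal_transformation \<psi>"
      using \<psi>(1) by (simp add: rotation_of_def)
    have rot: "\<And>x. \<xi> \<bullet> x = 0 \<Longrightarrow> adjoint \<psi> (e x) = e (rot \<xi> c x)"
      using form[of "adjoint \<psi>" c] \<psi>(2,3) orth
      by (simp add: adjoint_linear orthogonal_transformation_linear)
    have "f (adjoint \<psi> u) + e a \<bullet> u = f u" if u: "u \<in> unit_sphere ?\<alpha>" for u
    proof -
      obtain x where x: "u = e x" "\<xi> \<bullet> x = 0" "norm x = 1"
        using u by (auto simp: unit_sphere_def norm_e)
      then show ?thesis
        using sym[OF x(2)] rot[OF x(2)] norm_rot[OF \<xi> c x(2)]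
        by (simp add: F_def homogeneous_extension_unit norm_e inner)
    qed
    moreover have "e a \<in> ?\<alpha>"
      using a by simp
    ultimately have "\<psi> = id"
      using nosym[OF \<alpha>] \<psi>(1) unfolding direct_rigid_motion_symmetry_iff by blast
    then have "adjoint \<psi> p = p"
      using adjoint_orthogonal_transformation[OF orth, of p] by simp
    then have "p \<bullet> p = Re c * (p \<bullet> p) + Im c * (p \<bullet> q)"
      using \<psi>(2) by (metis inner_add_right inner_scaleR_right)
    then have "Re c = 1"
      using p pq by auto
    then show "c = 1"
      using c by (simp add: complex_eq_iff cmod_def)
  qed
  then obtain \<epsilon> b where \<epsilon>: "\<epsilon> = 1 \<or> \<epsilon> = -1" "\<And>x. G x = F (\<epsilon> *\<^sub>R x) + b \<bullet> x"
    by blast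
  then have "agree_mod_linear_on (homogeneous_extension f) (homogeneous_extension g) \<epsilon> (range e)"
    unfolding agree_mod_linear_on_def
    by (intro exI[of _ "e b"]) (auto simp: F_def G_def linear_scale[OF lin] inner)
  then show ?thesis
    using that \<epsilon>(1) by blast
qed

theorem theorem1p4:
  fixes f g :: "real^'n \<Rightarrow> real"
  assumes "CARD('n) \<ge> 3"
    and "C2_on_sphere f" and "C2_on_sphere g"
    and "\<And>\<alpha> :: (real^'n) set. subspace \<alpha> \<Longrightarrow> dim \<alpha> = 2 \<Longrightarrow>
      directly_congruent (hh_project \<alpha> (hedgehog UNIV f)) (hh_project \<alpha> (hedgehog UNIV g))"
    and "\<And>\<alpha> :: (real^'n) set. subspace \<alpha> \<Longrightarrow> dim \<alpha> = 2 \<Longrightarrow>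
      \<not> direct_rigid_motion_symmetry (hh_project \<alpha> (hedgehog UNIV f)) \<and>
      \<not> direct_rigid_motion_symmetry (hh_project \<alpha> (hedgehog UNIV g))"
  shows "\<exists>b. hedgehog UNIV g = hh_translate b (hedgehog UNIV f) \<or>
             hedgehog UNIV g = hh_translate b (hh_minus (hedgehog UNIV f))"
proof -
  let ?F = "homogeneous_extension f" and ?G = "homogeneous_extension g"
  have cong: "directly_congruent (hedgehog \<alpha> f) (hedgehog \<alpha> g)"
    and nosym: "\<not> direct_rigid_motion_symmetry (hedgehog \<alpha> f)"
    if "subspace \<alpha>" "dim \<alpha> = 2" for \<alpha>
    using assms(4,5)[OF that] by (simp_all add: hh_project_hedgehog)
  have dim: "3 \<le> DIM(real^'n)"
    using assms(1) by simp
  obtain \<epsilon> where \<epsilon>: "\<epsilon> = 1 \<or> \<epsilon> = -1"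
    and planes: "\<And>\<alpha>. subspace \<alpha> \<Longrightarrow> dim \<alpha> = 2 \<Longrightarrow> agree_mod_linear_on ?F ?G \<epsilon> \<alpha>"
  proof (rule common_sign[OF dim])
    fix V :: "(real^'n) set" assume V: "subspace V" "dim V = 3"
    then obtain e :: "real^3 \<Rightarrow> real^'n"
      where e: "linear e" "range e = V" "\<And>x. norm (e x) = norm x"
      using isometry_subspaces[of "UNIV :: (real^3) set" V] by auto
    have "e x \<bullet> e y = x \<bullet> y" for x y
      using e(3)[of x] e(3)[of y] e(3)[of "x + y"]
      by (simp add: dot_norm linear_add[OF e(1), symmetric])
    then show "agree_mod_linear_on ?F ?G 1 V \<or> agree_mod_linear_on ?F ?G (-1) V"
      using congruent_on_embedded_space[OF assms(2,3) cong nosym e(1)] e(2) by metis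
  next
    fix \<alpha> :: "(real^'n) set" assume "subspace \<alpha>" "dim \<alpha> = 2"
    then show "\<not> (agree_mod_linear_on ?F ?G 1 \<alpha> \<and> agree_mod_linear_on ?F ?G (-1) \<alpha>)"
      using congruence_sign_unique nosym by blast
  qed (rule that)
  have "\<exists>b. \<forall>x. ?G x - ?F (\<epsilon> *\<^sub>R x) = b \<bullet> x"
  proof (rule inner_if_linear_on_planes)
    show "2 \<le> DIM(real^'n)"
      using dim by simp
    show "\<exists>b. \<forall>x\<in>\<alpha>. ?G x - ?F (\<epsilon> *\<^sub>R x) = b \<bullet> x" if "subspace \<alpha>" "dim \<alpha> = 2" for \<alpha>
      using planes[OF that] unfolding agree_mod_linear_on_def by (simp add: algebra_simps)
  qed
  then obtain b where b: "\<And>x. ?G x - ?F (\<epsilon> *\<^sub>R x) = b \<bullet> x"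
    by blast
  have "g u = f (\<epsilon> *\<^sub>R u) + b \<bullet> u" if "norm u = 1" for u
    using b[of u] \<epsilon> that homogeneous_extension_unit[of u g] homogeneous_extension_unit[of "\<epsilon> *\<^sub>R u" f]
    by auto
  then show ?thesis
    using \<epsilon> unfolding hh_minus_hedgehog hh_translate_hedgehog hedgehog_eq_iff
    by (intro exI[of _ b]) (auto simp: unit_sphere_def)
qed

end
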